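(* The map $G=\Psi\circ\Phi^{-1}$ is a global isometry from $(\Omega,g^{\mathrm{LC}})$ onto Euclidean space $\mathbb{R}^5$. In particular, $g^{\mathrm{LC}}$ is flat and complete. Moreover, $\Omega$ is totally geodesic in the ambient cone $\mathrm{Sym}^{++}(3,\mathbb{R})$ endowed with the Log-Cholesky metric. Let $x,y\in\Omega$ have Cholesky factors $$T_x=\begin{pmatrix} a_1 & 0 & 0 \\ 0 & a_2 & 0 \\ u_4 & u_5 & a_3 \end{pmatrix},\qquad T_y=\begin{pmatrix} b_1 & 0 & 0 \\ 0 & b_2 & 0 \\ v_4 & v_5 & b_3 \end{pmatrix}.$$ The unique affinely parametrized $g^{\mathrm{LC}}$-geodesic joining $x$ to $y$ on $[0,1]$ is $\gamma^{\mathrm{LC}}_{x,y}(t)=\Phi(T(t))$, where $$T(t)=\begin{pmatrix} a_1^{1-t}b_1^t & 0 & 0 \\ 0 & a_2^{1-t}b_2^t & 0 \\ (1-t)u_4+tv_4 & (1-t)u_5+tv_5 & a_3^{1-t}b_3^t \end{pmatrix}.$$ Its midpoint is $x\,\#_{\mathrm{LC}}\,y=\Phi(T(1/2))$. Both the geodesic and its midpoint preserve the prescribed zero pattern of $\Omega$ (vanishing $(1,2)$ and $(2,1)$ entries).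
   Context: Let $V\subset \mathrm{Sym}(3,\mathbb{R})$ be the 5-dimensional space of real symmetric $3\times3$ matrices whose $(1,2)$ and $(2,1)$ entries are $0$, and let $\Omega\subset V$ be the open cone of positive definite matrices in $V$. $\mathrm{Sym}^{++}(3,\mathbb{R})$ is the cone of all real symmetric positive definite $3\times3$ matrices. Lin's Log-Cholesky metric on $\mathrm{Sym}^{++}(3,\mathbb{R})$ is the transport through the Cholesky diffeomorphism $L\mapsto LL^{\top}$ of the metric $\sum_{i=1}^3d(\log L_{ii})^2+\sum_{i>j}dL_{ij}^2$ on the space of real lower triangular $3\times3$ matrices $L$ with positive diagonal. Let $H$ be the group of such lower triangular matrices with $L_{21}=0$; $\Phi:H\to\Omega$, $\Phi(T)=TT^{\top}$, is a diffeomorphism and $T_x=\Phi^{-1}(x)$. For $T=\begin{pmatrix} a_1 & 0 & 0 \\ 0 & a_2 & 0 \\ u_4 & u_5 & a_3 \end{pmatrix}\in H$ put $\Psi(T)=(\log a_1,\log a_2,\log a_3,u_4,u_5)\in\mathbb{R}^5$. The restricted metric on $H$ is $g^{\mathrm{LC}}_H=\sum_{i=1}^3d(\log a_i)^2+du_4^2+du_5^2$, and $g^{\mathrm{LC}}$ is its transport to $\Omega$ through $\Phi$ (equivalently, the restriction to $\Omega$ of the ambient Log-Cholesky metric). *)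

theory Defs
  imports "HOL-Analysis.Analysis"
begin

text \<open>
  Riemannian geometry on a set \<open>U\<close> that is open in a linear subspace \<open>W\<close> of a Euclidean space.
  Every tangent space of \<open>U\<close> is \<open>W\<close>, so that a metric is a function
  \<open>g p v w\<close> that matters only for \<open>p \<in> U\<close> and \<open>v, w \<in> W\<close>.  Since \<open>U\<close> need not be open
  in the surrounding space, differentials are directional derivatives along \<open>W\<close>; they depend
  only on the values of the function on \<open>U\<close>.
\<close>

definition dir_deriv ::
    "('a::real_normed_vector \<Rightarrow> 'b::real_normed_vector) \<Rightarrow> 'a \<Rightarrow> 'a \<Rightarrow> 'b" where
  "dir_deriv f p v = vector_derivative (\<lambda>t. f (p + t *\<^sub>R v)) (at 0)"

primrec Ck_on ::
    "nat \<Rightarrow> 'a::real_normed_vector set \<Rightarrow> 'a set \<Rightarrow> ('a \<Rightarrow> 'b::real_normed_vector) \<Rightarrow> bool" where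
  "Ck_on 0 U W f \<longleftrightarrow> continuous_on U f"
| "Ck_on (Suc k) U W f \<longleftrightarrow> continuous_on U f \<and>
     (\<forall>v\<in>W. (\<forall>p\<in>U. (\<lambda>t. f (p + t *\<^sub>R v)) differentiable at (0::real)) \<and>
            Ck_on k U W (\<lambda>p. dir_deriv f p v))"

definition smooth_map_on ::
    "'a::real_normed_vector set \<Rightarrow> 'a set \<Rightarrow> ('a \<Rightarrow> 'b::real_normed_vector) \<Rightarrow> bool" where
  "smooth_map_on U W f \<longleftrightarrow> (\<forall>k. Ck_on k U W f)"

type_synonym 'a metric_tensor = "'a \<Rightarrow> 'a \<Rightarrow> 'a \<Rightarrow> real"

definition riemannian_metric_on ::
    "'a::euclidean_space set \<Rightarrow> 'a set \<Rightarrow> 'a metric_tensor \<Rightarrow> bool" where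
  "riemannian_metric_on U W g \<longleftrightarrow>
     subspace W \<and> openin (top_of_set W) U \<and>
     (\<forall>p\<in>U. \<forall>v\<in>W. \<forall>w\<in>W. g p v w = g p w v) \<and>
     (\<forall>p\<in>U. \<forall>v\<in>W. \<forall>w\<in>W. \<forall>z\<in>W. g p (v + w) z = g p v z + g p w z) \<and>
     (\<forall>p\<in>U. \<forall>v\<in>W. \<forall>z\<in>W. \<forall>c. g p (c *\<^sub>R v) z = c * g p v z) \<and>
     (\<forall>p\<in>U. \<forall>v\<in>W. v \<noteq> 0 \<longrightarrow> 0 < g p v v) \<and>
     (\<forall>v\<in>W. \<forall>w\<in>W. smooth_map_on U W (\<lambda>p. g p v w))"

definition standard_metric :: "'a::euclidean_space metric_tensor" where
  "standard_metric p v w = v \<bullet> w"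

text \<open>The metric on \<open>f ` S\<close> that makes \<open>f\<close>, a diffeomorphism on \<open>S\<close>, an isometry.\<close>

definition transport_metric ::
    "'a::euclidean_space set \<Rightarrow> ('a \<Rightarrow> 'b::euclidean_space) \<Rightarrow> 'a metric_tensor \<Rightarrow> 'b metric_tensor"
  where
  "transport_metric S f g y v w =
     g (inv_into S f y) (dir_deriv (inv_into S f) y v) (dir_deriv (inv_into S f) y w)"

definition diffeomorphism_on ::
    "'a::euclidean_space set \<Rightarrow> 'a set \<Rightarrow> 'b::euclidean_space set \<Rightarrow> 'b set \<Rightarrow> ('a \<Rightarrow> 'b) \<Rightarrow> bool"
  where
  "diffeomorphism_on U W U' W' f \<longleftrightarrow>
     bij_betw f U U' \<and> smooth_map_on U W f \<and> smooth_map_on U' W' (inv_into U f)"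

definition riemannian_isometry ::
    "'a::euclidean_space set \<Rightarrow> 'a set \<Rightarrow> 'a metric_tensor \<Rightarrow>
     'b::euclidean_space set \<Rightarrow> 'b set \<Rightarrow> 'b metric_tensor \<Rightarrow> ('a \<Rightarrow> 'b) \<Rightarrow> bool" where
  "riemannian_isometry U W g U' W' g' f \<longleftrightarrow>
     riemannian_metric_on U W g \<and> riemannian_metric_on U' W' g' \<and>
     diffeomorphism_on U W U' W' f \<and>
     (\<forall>p\<in>U. \<forall>v\<in>W. \<forall>w\<in>W. g' (f p) (dir_deriv f p v) (dir_deriv f p w) = g p v w)"

text \<open>
  The Levi-Civita derivative at \<open>p\<close> of the constant field \<open>w\<close> in direction \<open>v\<close>, given by the
  Koszul formula; constant fields commute, so no bracket terms occur.
\<close>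

definition christoffel ::
    "'a::euclidean_space set \<Rightarrow> 'a metric_tensor \<Rightarrow> 'a \<Rightarrow> 'a \<Rightarrow> 'a \<Rightarrow> 'a" where
  "christoffel W g p v w = (THE c. c \<in> W \<and> (\<forall>z\<in>W.
     2 * g p c z = dir_deriv (\<lambda>q. g q w z) p v + dir_deriv (\<lambda>q. g q v z) p w
                   - dir_deriv (\<lambda>q. g q v w) p z))"

text \<open>\<open>R(v,w)z = \<nabla>\<^sub>v \<nabla>\<^sub>w z - \<nabla>\<^sub>w \<nabla>\<^sub>v z\<close> for constant fields \<open>v, w, z\<close>.\<close>

definition riemann_curvature ::
    "'a::euclidean_space set \<Rightarrow> 'a metric_tensor \<Rightarrow> 'a \<Rightarrow> 'a \<Rightarrow> 'a \<Rightarrow> 'a \<Rightarrow> 'a" where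
  "riemann_curvature W g p v w z =
     (dir_deriv (\<lambda>q. christoffel W g q w z) p v + christoffel W g p v (christoffel W g p w z))
     - (dir_deriv (\<lambda>q. christoffel W g q v z) p w + christoffel W g p w (christoffel W g p v z))"

definition flat_metric ::
    "'a::euclidean_space set \<Rightarrow> 'a set \<Rightarrow> 'a metric_tensor \<Rightarrow> bool" where
  "flat_metric U W g \<longleftrightarrow>
     (\<forall>p\<in>U. \<forall>v\<in>W. \<forall>w\<in>W. \<forall>z\<in>W. riemann_curvature W g p v w z = 0)"

text \<open>
  Affinely parametrized geodesics on an interval \<open>I\<close>: the covariant acceleration vanishes.
  Derivatives are one-sided at end points belonging to \<open>I\<close>.
\<close>

definition geodesic_on ::
    "'a::euclidean_space set \<Rightarrow> 'a set \<Rightarrow> 'a metric_tensor \<Rightarrow> real set \<Rightarrow> (real \<Rightarrow> 'a) \<Rightarrow> bool" where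
  "geodesic_on U W g I \<gamma> \<longleftrightarrow> (\<forall>t\<in>I. \<gamma> t \<in> U) \<and>
     (\<exists>\<gamma>1 \<gamma>2. \<forall>t\<in>I.
        (\<gamma> has_vector_derivative \<gamma>1 t) (at t within I) \<and>
        (\<gamma>1 has_vector_derivative \<gamma>2 t) (at t within I) \<and>
        \<gamma>2 t + christoffel W g (\<gamma> t) (\<gamma>1 t) (\<gamma>1 t) = 0)"

definition geodesic_joining ::
    "'a::euclidean_space set \<Rightarrow> 'a set \<Rightarrow> 'a metric_tensor \<Rightarrow> 'a \<Rightarrow> 'a \<Rightarrow> (real \<Rightarrow> 'a) \<Rightarrow> bool" where
  "geodesic_joining U W g x y \<gamma> \<longleftrightarrow> geodesic_on U W g {0..1} \<gamma> \<and> \<gamma> 0 = x \<and> \<gamma> 1 = y"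

text \<open>Meaningful when \<open>x\<close> and \<open>y\<close> are joined by exactly one geodesic on \<open>[0,1]\<close>.\<close>

definition geodesic_midpoint ::
    "'a::euclidean_space set \<Rightarrow> 'a set \<Rightarrow> 'a metric_tensor \<Rightarrow> 'a \<Rightarrow> 'a \<Rightarrow> 'a" where
  "geodesic_midpoint U W g x y = (THE m. \<exists>\<gamma>. geodesic_joining U W g x y \<gamma> \<and> m = \<gamma> (1/2))"

definition geodesically_complete ::
    "'a::euclidean_space set \<Rightarrow> 'a set \<Rightarrow> 'a metric_tensor \<Rightarrow> bool" where
  "geodesically_complete U W g \<longleftrightarrow>
     (\<forall>p\<in>U. \<forall>v\<in>W. \<exists>\<gamma>. geodesic_on U W g UNIV \<gamma> \<and> \<gamma> 0 = p \<and>
        (\<gamma> has_vector_derivative v) (at 0))"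

text \<open>
  \<open>(U, g)\<close> is a Riemannian submanifold of \<open>(U', g')\<close>, that is, \<open>g\<close> is the induced metric, and
  every geodesic of \<open>(U, g)\<close> is a geodesic of \<open>(U', g')\<close>.
\<close>

definition totally_geodesic_in ::
    "'a::euclidean_space set \<Rightarrow> 'a set \<Rightarrow> 'a metric_tensor \<Rightarrow> 'a set \<Rightarrow> 'a set \<Rightarrow> 'a metric_tensor \<Rightarrow> bool"
  where
  "totally_geodesic_in U W g U' W' g' \<longleftrightarrow>
     riemannian_metric_on U W g \<and> riemannian_metric_on U' W' g' \<and> U \<subseteq> U' \<and> W \<subseteq> W' \<and>
     (\<forall>p\<in>U. \<forall>v\<in>W. \<forall>w\<in>W. g p v w = g' p v w) \<and>
     (\<forall>I \<gamma>. open I \<and> is_interval I \<and> geodesic_on U W g I \<gamma> \<longrightarrow> geodesic_on U' W' g' I \<gamma>)"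

text \<open>
  In the index type \<open>3\<close> one has \<open>3 = 0 < 1 < 2\<close>; the matrix shapes below are
  therefore spelled out entrywise and not through the order on indices.
\<close>

definition Sym3 :: "(real^3^3) set" where
  "Sym3 = {A. transpose A = A}"

definition positive_definite :: "real^3^3 \<Rightarrow> bool" where
  "positive_definite A \<longleftrightarrow> (\<forall>\<xi>. \<xi> \<noteq> 0 \<longrightarrow> 0 < \<xi> \<bullet> (A *v \<xi>))"

definition SymPD3 :: "(real^3^3) set" where
  "SymPD3 = {A \<in> Sym3. positive_definite A}"

definition V_space :: "(real^3^3) set" where
  "V_space = {A \<in> Sym3. A$1$2 = 0 \<and> A$2$1 = 0}"

definition Omega :: "(real^3^3) set" where
  "Omega = {A \<in> V_space. positive_definite A}"

definition LowerPos3 :: "(real^3^3) set" where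
  "LowerPos3 = {L. L$1$2 = 0 \<and> L$1$3 = 0 \<and> L$2$3 = 0 \<and> (\<forall>i. 0 < L$i$i)}"

definition H_group :: "(real^3^3) set" where
  "H_group = {T \<in> LowerPos3. T$2$1 = 0}"

definition Phi :: "real^3^3 \<Rightarrow> real^3^3" where
  "Phi T = T ** transpose T"

text \<open>On a tangent vector \<open>X\<close> at \<open>L\<close>, \<open>d(log L\<^sub>i\<^sub>i)\<close> takes the value \<open>X$i$i / L$i$i\<close>.\<close>

definition g_lower :: "(real^3^3) metric_tensor" where
  "g_lower L X Y = (\<Sum>i\<in>UNIV. (X$i$i / L$i$i) * (Y$i$i / L$i$i))
     + X$2$1 * Y$2$1 + X$3$1 * Y$3$1 + X$3$2 * Y$3$2"

definition g_H :: "(real^3^3) metric_tensor" where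
  "g_H T X Y = (\<Sum>i\<in>UNIV. (X$i$i / T$i$i) * (Y$i$i / T$i$i))
     + X$3$1 * Y$3$1 + X$3$2 * Y$3$2"

definition g_LC_ambient :: "(real^3^3) metric_tensor" where
  "g_LC_ambient = transport_metric LowerPos3 (\<lambda>L. L ** transpose L) g_lower"

definition g_LC :: "(real^3^3) metric_tensor" where
  "g_LC = transport_metric H_group Phi g_H"

definition Psi :: "real^3^3 \<Rightarrow> real^5" where
  "Psi T = vector [ln (T$1$1), ln (T$2$2), ln (T$3$3), T$3$1, T$3$2]"

definition G_map :: "real^3^3 \<Rightarrow> real^5" where
  "G_map = Psi \<circ> inv_into H_group Phi"

definition H_mat :: "real \<Rightarrow> real \<Rightarrow> real \<Rightarrow> real \<Rightarrow> real \<Rightarrow> real^3^3" where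
  "H_mat a1 a2 a3 u4 u5 = vector [vector [a1, 0, 0], vector [0, a2, 0], vector [u4, u5, a3]]"

end

theory Submission
  imports Defs
begin

text \<open>
  The map \<open>G\<close> is a global diffeomorphism onto \<open>\<real>\<^sup>5\<close> under which the Log-Cholesky metric is the
  pull-back of the standard one. For any such chart \<open>F\<close> with inverse \<open>K\<close> the Koszul formula gives the
  Levi-Civita connection \<open>dK(D\<^sup>2F(v,w))\<close>, so the covariant acceleration of a curve \<open>\<gamma>\<close> is mapped by
  \<open>dF\<close> to the second derivative of \<open>F \<circ> \<gamma>\<close>. Hence geodesics are the curves whose image is an affinely
  parametrized segment. The ambient cone has a chart of the same kind, with \<open>L\<^sub>2\<^sub>1\<close> as sixth coordinate,
  and in it \<open>\<Omega>\<close> is the hyperplane \<open>L\<^sub>2\<^sub>1 = 0\<close>.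
\<close>

section \<open>Smooth maps\<close>

text \<open>Two obstacles shape the development. Smoothness is defined by iterated directional
  derivatives, which by themselves give no chain rule, while inverting charts and following curves
  needs one; hence the detour through Frechet derivatives within \<open>U\<close>. And
  \<open>U\<close> is open only in \<open>W\<close>, so these derivatives are not unique in
  directions off \<open>W\<close>: velocities, accelerations and Christoffel values have to be shown
  to lie in \<open>W\<close> before they can be used. Once \<open>dF\<close> is known to be
  injective on \<open>W\<close> with inverse \<open>dK\<close>, identities between tangent vectors
  are checked after applying \<open>dF\<close>, where they concern ordinary derivatives. Flatness
  becomes the symmetry of second directional derivatives of the map sending \<open>q\<close> to
  \<open>dF_q(z)\<close>. Completeness and the existence of joining geodesics rest on the chart
  being onto the whole Euclidean space: an affine line never leaves its range. For smooth charts and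
  open cones, the Cholesky inverse is used in explicit form. It is built from quotients and square
  roots of pivots, and on symmetric matrices these pivots are positive exactly when certain
  polynomial minors are.\<close>

text \<open>
  The closure properties needed below are proved for Frechet derivatives and then transferred to
  \<^const>\<open>Ck_on\<close>. The derivative \<open>f' p\<close> is arbitrary on vectors transversal to the linear span
  of \<open>U\<close>, so one choice of it has to be smooth in \<open>p\<close> in all directions.
\<close>

primrec Fk_on :: "nat \<Rightarrow> 'a::real_normed_vector set \<Rightarrow> ('a \<Rightarrow> 'b::real_normed_vector) \<Rightarrow> bool" where
  "Fk_on 0 U f \<longleftrightarrow> continuous_on U f"
| "Fk_on (Suc k) U f \<longleftrightarrow>
     (\<exists>f'. (\<forall>p\<in>U. (f has_derivative f' p) (at p within U)) \<and> (\<forall>v. Fk_on k U (\<lambda>p. f' p v)))"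

lemma Fk_on_SucI:
  assumes "\<And>p. p \<in> U \<Longrightarrow> (f has_derivative f' p) (at p within U)" "\<And>v. Fk_on k U (\<lambda>p. f' p v)"
  shows "Fk_on (Suc k) U f"
  using assms by auto

lemma Fk_on_SucE:
  assumes "Fk_on (Suc k) U f"
  obtains f' where "\<And>p. p \<in> U \<Longrightarrow> (f has_derivative f' p) (at p within U)"
    "\<And>v. Fk_on k U (\<lambda>p. f' p v)"
  using assms by auto

lemma Fk_on_SucD: "Fk_on (Suc k) U f \<Longrightarrow> Fk_on k U f"
proof (induction k arbitrary: f)
  case 0
  then show ?case
    by (auto simp: continuous_on_eq_continuous_within intro: has_derivative_continuous)
next
  case (Suc k)
  from Suc.prems obtain f' where "\<And>p. p \<in> U \<Longrightarrow> (f has_derivative f' p) (at p within U)"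
    "\<And>v. Fk_on (Suc k) U (\<lambda>p. f' p v)" by (metis Fk_on_SucE)
  then show ?case by (intro Fk_on_SucI[where f' = f']) (auto intro: Suc.IH simp del: Fk_on.simps)
qed

lemma Fk_on_imp_continuous_on: "Fk_on k U f \<Longrightarrow> continuous_on U f"
  by (induction k) (use Fk_on_SucD in \<open>auto simp del: Fk_on.simps(2)\<close>)

lemma Fk_on_cong:
  assumes "\<And>p. p \<in> U \<Longrightarrow> f p = g p"
  shows "Fk_on k U f \<longleftrightarrow> Fk_on k U g"
proof (cases k)
  case 0
  then show ?thesis using assms by (simp cong: continuous_on_cong)
next
  case (Suc n)
  have "(f has_derivative f') (at p within U) \<longleftrightarrow> (g has_derivative f') (at p within U)"
    if "p \<in> U" for f' p
    using assms that by (metis has_derivative_transform)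
  then show ?thesis using Suc by auto
qed

lemma Fk_on_subset: "Fk_on k U f \<Longrightarrow> V \<subseteq> U \<Longrightarrow> Fk_on k V f"
proof (induction k arbitrary: f)
  case 0
  then show ?case by (auto intro: continuous_on_subset)
next
  case (Suc k)
  then obtain f' where "\<And>p. p \<in> U \<Longrightarrow> (f has_derivative f' p) (at p within U)"
    "\<And>v. Fk_on k U (\<lambda>p. f' p v)" by (metis Fk_on_SucE)
  with Suc show ?case
    by (intro Fk_on_SucI[where f' = f']) (auto intro: has_derivative_subset)
qed

lemma Fk_on_const: "Fk_on k U (\<lambda>p. c)"
  by (induction k arbitrary: c)
    (auto intro!: Fk_on_SucI[where f' = "\<lambda>p v. 0"] simp del: Fk_on.simps(2))

lemma (in bounded_linear) Fk_on: "Fk_on k U g \<Longrightarrow> Fk_on k U (\<lambda>p. f (g p))"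
proof (induction k arbitrary: g)
  case 0
  then show ?case by (auto intro: continuous_on)
next
  case (Suc k)
  then obtain g' where "\<And>p. p \<in> U \<Longrightarrow> (g has_derivative g' p) (at p within U)"
    "\<And>v. Fk_on k U (\<lambda>p. g' p v)" by (metis Fk_on_SucE)
  with Suc show ?case
    by (intro Fk_on_SucI[where f' = "\<lambda>p v. f (g' p v)"]) (auto intro: has_derivative)
qed

lemma Fk_on_ident: "Fk_on k U (\<lambda>p. p)"
  by (cases k) (auto intro!: Fk_on_SucI[where f' = "\<lambda>p v. v"] Fk_on_const has_derivative_ident simp del: Fk_on.simps(2))

lemma Fk_on_add: "Fk_on k U f \<Longrightarrow> Fk_on k U g \<Longrightarrow> Fk_on k U (\<lambda>p. f p + g p)"
proof (induction k arbitrary: f g)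
  case 0
  then show ?case by (auto intro: continuous_on_add)
next
  case (Suc k)
  obtain f' where "\<And>p. p \<in> U \<Longrightarrow> (f has_derivative f' p) (at p within U)"
    "\<And>v. Fk_on k U (\<lambda>p. f' p v)" using Suc.prems(1) by (metis Fk_on_SucE)
  moreover obtain g' where "\<And>p. p \<in> U \<Longrightarrow> (g has_derivative g' p) (at p within U)"
    "\<And>v. Fk_on k U (\<lambda>p. g' p v)" using Suc.prems(2) by (metis Fk_on_SucE)
  ultimately show ?case
    by (intro Fk_on_SucI[where f' = "\<lambda>p v. f' p v + g' p v"])
      (auto intro: has_derivative_add Suc.IH)
qed

lemma (in bounded_bilinear) Fk_on:
  "Fk_on k U f \<Longrightarrow> Fk_on k U g \<Longrightarrow> Fk_on k U (\<lambda>p. prod (f p) (g p))"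
proof (induction k arbitrary: f g)
  case 0
  then show ?case by (auto intro: continuous_on)
next
  case (Suc k)
  obtain f' where "\<And>p. p \<in> U \<Longrightarrow> (f has_derivative f' p) (at p within U)"
    "\<And>v. Fk_on k U (\<lambda>p. f' p v)" using Suc.prems(1) by (metis Fk_on_SucE)
  moreover obtain g' where "\<And>p. p \<in> U \<Longrightarrow> (g has_derivative g' p) (at p within U)"
    "\<And>v. Fk_on k U (\<lambda>p. g' p v)" using Suc.prems(2) by (metis Fk_on_SucE)
  moreover have "Fk_on k U f" "Fk_on k U g" using Suc.prems Fk_on_SucD by blast+
  ultimately show ?case
    by (intro Fk_on_SucI[where f' = "\<lambda>p v. prod (f p) (g' p v) + prod (f' p v) (g p)"])
      (auto intro: FDERIV Fk_on_add[OF Suc.IH Suc.IH])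
qed

lemmas Fk_on_scaleR = bounded_bilinear.Fk_on[OF bounded_bilinear_scaleR]
lemmas Fk_on_mult = bounded_bilinear.Fk_on[OF bounded_bilinear_mult]
lemmas Fk_on_inner = bounded_bilinear.Fk_on[OF bounded_bilinear_inner]
lemmas Fk_on_nth = bounded_linear.Fk_on[OF bounded_linear_vec_nth]

lemma Fk_on_minus: "Fk_on k U f \<Longrightarrow> Fk_on k U (\<lambda>p. - f p)"
  by (rule bounded_linear.Fk_on[OF bounded_linear_minus[OF bounded_linear_ident]])

lemma Fk_on_diff: "Fk_on k U f \<Longrightarrow> Fk_on k U g \<Longrightarrow> Fk_on k U (\<lambda>p. f p - g p)"
  using Fk_on_add[OF _ Fk_on_minus, of k U f g] by simp

lemma Fk_on_sum:
  "(\<And>i. i \<in> I \<Longrightarrow> Fk_on k U (f i)) \<Longrightarrow> Fk_on k U (\<lambda>p. \<Sum>i\<in>I. f i p)"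
  by (induction I rule: infinite_finite_induct) (auto intro: Fk_on_const Fk_on_add)

text \<open>The derivative contains \<open>inverse (f p)\<close> again, so the induction is on the
  order alone, with \<open>f\<close> fixed: smoothness of lower order of the inverse is fed back
  into its own derivative.\<close>

lemma Fk_on_inverse:
  fixes f :: "'a::real_normed_vector \<Rightarrow> real"
  assumes "Fk_on k U f" and nz: "\<And>p. p \<in> U \<Longrightarrow> f p \<noteq> 0"
  shows "Fk_on k U (\<lambda>p. inverse (f p))"
  using assms(1)
proof (induction k)
  case 0
  then show ?case using nz by (auto intro!: continuous_on_inverse)
next
  case (Suc k)
  from Suc.prems obtain f' where d: "\<And>p. p \<in> U \<Longrightarrow> (f has_derivative f' p) (at p within U)"
    "\<And>v. Fk_on k U (\<lambda>p. f' p v)" by (metis Fk_on_SucE)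
  have "Fk_on k U (\<lambda>p. inverse (f p))" using Suc Fk_on_SucD by blast
  with d show ?case
    by (intro Fk_on_SucI[where f' = "\<lambda>p v. - (inverse (f p) * f' p v * inverse (f p))"])
      (auto intro!: has_derivative_inverse Fk_on_minus Fk_on_mult simp: nz)
qed

lemma Fk_on_divide:
  fixes f :: "'a::real_normed_vector \<Rightarrow> real"
  assumes "Fk_on k U f" "Fk_on k U g" "\<And>p. p \<in> U \<Longrightarrow> g p \<noteq> 0"
  shows "Fk_on k U (\<lambda>p. f p / g p)"
  unfolding divide_inverse by (intro Fk_on_mult Fk_on_inverse assms)

text \<open>One differentiation already leads to \<open>inverse (f p)\<close>, so a case distinction
  replaces the induction.\<close>

lemma Fk_on_ln:
  fixes f :: "'a::real_normed_vector \<Rightarrow> real"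
  assumes "Fk_on k U f" and pos: "\<And>p. p \<in> U \<Longrightarrow> 0 < f p"
  shows "Fk_on k U (\<lambda>p. ln (f p))"
proof (cases k)
  case 0
  then show ?thesis using assms(1) pos by (auto intro!: continuous_on_ln dest: pos)
next
  case (Suc n)
  then obtain f' where d: "\<And>p. p \<in> U \<Longrightarrow> (f has_derivative f' p) (at p within U)"
    "\<And>v. Fk_on n U (\<lambda>p. f' p v)" using assms(1) by (metis Fk_on_SucE)
  have "Fk_on n U (\<lambda>p. inverse (f p))" using Suc assms Fk_on_SucD
    by (intro Fk_on_inverse) (auto simp: less_imp_neq simp del: Fk_on.simps dest!: pos)
  with d show ?thesis unfolding Suc
    by (intro Fk_on_SucI[where f' = "\<lambda>p v. f' p v * inverse (f p)"])
      (auto intro!: has_derivative_ln Fk_on_mult simp: pos)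
qed

lemma Fk_on_exp:
  fixes f :: "'a::real_normed_vector \<Rightarrow> real"
  assumes "Fk_on k U f"
  shows "Fk_on k U (\<lambda>p. exp (f p))"
  using assms
proof (induction k)
  case 0
  then show ?case by (auto intro!: continuous_on_exp)
next
  case (Suc k)
  from Suc.prems obtain f' where d: "\<And>p. p \<in> U \<Longrightarrow> (f has_derivative f' p) (at p within U)"
    "\<And>v. Fk_on k U (\<lambda>p. f' p v)" by (metis Fk_on_SucE)
  have "Fk_on k U (\<lambda>p. exp (f p))" using Suc Fk_on_SucD by blast
  with d show ?case
    by (intro Fk_on_SucI[where f' = "\<lambda>p v. f' p v * exp (f p)"])
      (auto intro!: has_derivative_exp Fk_on_mult)
qed

text \<open>On positive values the square root is \<open>exp (ln (f p) / 2)\<close>, so the rules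
  for \<open>exp\<close> and \<open>ln\<close> apply.\<close>

lemma Fk_on_sqrt:
  fixes f :: "'a::real_normed_vector \<Rightarrow> real"
  assumes f: "Fk_on k U f" and pos: "\<And>p. p \<in> U \<Longrightarrow> 0 < f p"
  shows "Fk_on k U (\<lambda>p. sqrt (f p))"
proof -
  have "Fk_on k U (\<lambda>p. exp (ln (f p) * (1/2)))"
    by (intro Fk_on_exp Fk_on_mult Fk_on_const Fk_on_ln f pos)
  also have "?this \<longleftrightarrow> ?thesis"
    by (intro Fk_on_cong) (auto dest!: pos simp: powr_half_sqrt[symmetric] powr_def mult.commute)
  finally show ?thesis .
qed

lemma Fk_on_componentwise:
  fixes f :: "'a::real_normed_vector \<Rightarrow> 'b::euclidean_space"
  assumes "\<And>b. b \<in> Basis \<Longrightarrow> Fk_on k U (\<lambda>p. f p \<bullet> b)"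
  shows "Fk_on k U f"
proof -
  have "Fk_on k U (\<lambda>p. \<Sum>b\<in>Basis. (f p \<bullet> b) *\<^sub>R b)"
    by (intro Fk_on_sum Fk_on_scaleR Fk_on_const assms)
  then show ?thesis by (simp add: euclidean_representation)
qed

lemma Fk_on_vec:
  fixes f :: "'a::real_normed_vector \<Rightarrow> 'b::euclidean_space ^ 'n"
  assumes "\<And>i. Fk_on k U (\<lambda>p. f p $ i)"
  shows "Fk_on k U f"
proof (rule Fk_on_componentwise)
  fix b :: "'b ^ 'n" assume "b \<in> Basis"
  then obtain i u where "b = axis i u" by (auto simp: Basis_vec_def)
  then show "Fk_on k U (\<lambda>p. f p \<bullet> b)" by (simp add: inner_axis Fk_on_inner Fk_on_const assms)
qed

lemma Fk_on_Pair:
  fixes f :: "'a::real_normed_vector \<Rightarrow> 'b::euclidean_space" and g :: "'a \<Rightarrow> 'c::euclidean_space"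
  assumes "Fk_on k U f" "Fk_on k U g"
  shows "Fk_on k U (\<lambda>p. (f p, g p))"
proof (rule Fk_on_componentwise)
  fix b :: "'b \<times> 'c" assume "b \<in> Basis"
  show "Fk_on k U (\<lambda>p. (f p, g p) \<bullet> b)"
    by (cases b) (simp add: inner_Pair Fk_on_add Fk_on_inner Fk_on_const assms)
qed

section \<open>Directional derivatives along a subspace\<close>

lemma eventually_line_in_openin:
  fixes p :: "'a::real_normed_vector"
  assumes "subspace W" "openin (top_of_set W) U" "p \<in> U" "v \<in> W"
  shows "\<forall>\<^sub>F t in at (0::real). p + t *\<^sub>R v \<in> U"
proof -
  obtain T where T: "open T" "U = W \<inter> T" using assms(2) by (auto simp: openin_open)
  have "((\<lambda>t::real. p + t *\<^sub>R v) \<longlongrightarrow> p + 0 *\<^sub>R v) (at 0)" by (intro tendsto_intros)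
  then have "\<forall>\<^sub>F t in at (0::real). p + t *\<^sub>R v \<in> T"
    using topological_tendstoD T assms(3) by fastforce
  then show ?thesis
    by eventually_elim (use T assms in \<open>auto intro: subspace_add subspace_scale\<close>)
qed

lemma line_has_vector_derivative_cong:
  fixes f g :: "'a::real_normed_vector \<Rightarrow> 'b::real_normed_vector"
  assumes "subspace W" "openin (top_of_set W) U" "p \<in> U" "v \<in> W" "\<And>q. q \<in> U \<Longrightarrow> f q = g q"
  shows "((\<lambda>t. f (p + t *\<^sub>R v)) has_vector_derivative d) (at 0) \<longleftrightarrow>
    ((\<lambda>t. g (p + t *\<^sub>R v)) has_vector_derivative d) (at 0)"
  using eventually_line_in_openin[OF assms(1-4)] assms(3,5)
  by (intro has_vector_derivative_cong_ev) (auto simp: eventually_at_filter elim: eventually_mono)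

lemma dir_deriv_cong:
  assumes "subspace W" "openin (top_of_set W) U" "p \<in> U" "v \<in> W" "\<And>q. q \<in> U \<Longrightarrow> f q = g q"
  shows "dir_deriv f p v = dir_deriv g p v"
  unfolding dir_deriv_def vector_derivative_def
  by (subst line_has_vector_derivative_cong[where f = f and g = g, OF assms]) auto

lemma has_derivative_imp_line_derivative:
  assumes W: "subspace W" "openin (top_of_set W) U" "p \<in> U" "v \<in> W"
    and f: "(f has_derivative f') (at p within U)"
  shows "((\<lambda>t. f (p + t *\<^sub>R v)) has_vector_derivative f' v) (at 0)"
proof -
  from eventually_line_in_openin[OF W] obtain d
    where d: "d > 0" "\<And>t::real. dist t 0 < d \<Longrightarrow> t \<noteq> 0 \<Longrightarrow> p + t *\<^sub>R v \<in> U"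
    by (auto simp: eventually_at)
  \<comment> \<open>The parameter is restricted so far that the whole segment lies in
    \<open>U\<close>. The derivative of \<open>f\<close> within \<open>U\<close> can then be
    composed with it, and on the open ball the result is an ordinary two-sided derivative.\<close>
  let ?B = "ball (0::real) d"
  have im: "(\<lambda>t. p + t *\<^sub>R v) ` ?B \<subseteq> U"
    using d(2) W(3) by (auto simp: dist_commute) (metis add.right_neutral scaleR_zero_left)
  have l: "((\<lambda>t. p + t *\<^sub>R v) has_derivative (\<lambda>t. t *\<^sub>R v)) (at 0 within ?B)"
    by (auto intro!: derivative_eq_intros)
  have "(f has_derivative f') (at (p + 0 *\<^sub>R v) within (\<lambda>t. p + t *\<^sub>R v) ` ?B)"
    using has_derivative_subset[OF f im] by simp
  from has_derivative_in_compose[OF l this]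
  have "((\<lambda>t. f (p + t *\<^sub>R v)) has_derivative (\<lambda>t. f' (t *\<^sub>R v))) (at 0)"
    using d(1) at_within_open[of 0 ?B] by simp
  moreover have "(\<lambda>t. f' (t *\<^sub>R v)) = (\<lambda>t. t *\<^sub>R f' v)"
    using linear_scale[OF has_derivative_linear[OF f]] by auto
  ultimately show ?thesis by (simp add: has_vector_derivative_def)
qed

lemma has_derivative_imp_dir_deriv:
  assumes "subspace W" "openin (top_of_set W) U" "p \<in> U" "v \<in> W"
    and "(f has_derivative f') (at p within U)"
  shows "dir_deriv f p v = f' v"
  unfolding dir_deriv_def by (rule vector_derivative_at[OF has_derivative_imp_line_derivative[OF assms]])

lemma Ck_on_cong:
  assumes "subspace W" "openin (top_of_set W) U" "\<And>q. q \<in> U \<Longrightarrow> f q = g q"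
  shows "Ck_on k U W f \<longleftrightarrow> Ck_on k U W g"
  using assms(3)
proof (induction k arbitrary: f g)
  case 0
  then show ?case by (simp cong: continuous_on_cong)
next
  case (Suc k)
  have c: "continuous_on U f \<longleftrightarrow> continuous_on U g" using Suc.prems by (simp cong: continuous_on_cong)
  have k: "Ck_on k U W (\<lambda>p. dir_deriv f p v) \<longleftrightarrow> Ck_on k U W (\<lambda>p. dir_deriv g p v)" if "v \<in> W" for v
    by (rule Suc.IH) (use that Suc.prems assms in \<open>auto intro: dir_deriv_cong\<close>)
  have d: "(\<lambda>t. f (p + t *\<^sub>R v)) differentiable at (0::real) \<longleftrightarrow>
      (\<lambda>t. g (p + t *\<^sub>R v)) differentiable at (0::real)" if "p \<in> U" "v \<in> W" for p v
    using line_has_vector_derivative_cong[where f = f and g = g, OF assms(1,2) that Suc.prems]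
      vector_derivative_works[of _ "at (0::real)"] differentiableI_vector by metis
  show ?case using c k d by auto
qed

text \<open>On \<open>U\<close> and for \<open>v\<close> in \<open>W\<close> the directional
  derivative is \<open>f' p v\<close>, which is smooth of the next lower order;
  \<open>Ck_on_cong\<close> allows the exchange because only values on \<open>U\<close>
  count.\<close>

lemma Fk_on_imp_Ck_on:
  assumes "subspace W" "openin (top_of_set W) U" "Fk_on k U f"
  shows "Ck_on k U W f"
  using assms(3)
proof (induction k arbitrary: f)
  case 0
  then show ?case by simp
next
  case (Suc k)
  from Suc.prems obtain f' where d: "\<And>p. p \<in> U \<Longrightarrow> (f has_derivative f' p) (at p within U)"
    "\<And>v. Fk_on k U (\<lambda>p. f' p v)" by (metis Fk_on_SucE)
  have "Ck_on k U W (\<lambda>p. dir_deriv f p v)" if "v \<in> W" for v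
  proof -
    have "Ck_on k U W (\<lambda>p. dir_deriv f p v) \<longleftrightarrow> Ck_on k U W (\<lambda>p. f' p v)"
      using that d(1) assms
      by (intro Ck_on_cong) (auto intro: has_derivative_imp_dir_deriv)
    then show ?thesis using Suc.IH[OF d(2)] by simp
  qed
  moreover have "(\<lambda>t. f (p + t *\<^sub>R v)) differentiable at (0::real)" if "p \<in> U" "v \<in> W" for p v
    using has_derivative_imp_line_derivative[OF assms(1,2) that d(1)[OF that(1)]]
    by (rule differentiableI_vector)
  ultimately show ?case using Fk_on_imp_continuous_on[OF Suc.prems] by simp
qed

lemma Fk_on_compose:
  fixes f :: "'a::real_normed_vector \<Rightarrow> 'b::euclidean_space" and g :: "'b \<Rightarrow> 'c::real_normed_vector"
  assumes "Fk_on k V g" "Fk_on k U f" and im: "f ` U \<subseteq> V"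
  shows "Fk_on k U (\<lambda>p. g (f p))"
  using assms(1,2)
proof (induction k arbitrary: g)
  case 0
  then show ?case using im continuous_on_compose2 by auto
next
  case (Suc k)
  obtain f' where f': "\<And>p. p \<in> U \<Longrightarrow> (f has_derivative f' p) (at p within U)"
    "\<And>v. Fk_on k U (\<lambda>p. f' p v)" using Suc.prems(2) by (metis Fk_on_SucE)
  obtain g' where g': "\<And>q. q \<in> V \<Longrightarrow> (g has_derivative g' q) (at q within V)"
    "\<And>v. Fk_on k V (\<lambda>q. g' q v)" using Suc.prems(1) by (metis Fk_on_SucE)
  have f: "Fk_on k U f" using Suc.prems(2) by (rule Fk_on_SucD)
  show ?case
  proof (rule Fk_on_SucI)
    show "((\<lambda>p. g (f p)) has_derivative (\<lambda>v. g' (f p) (f' p v))) (at p within U)" if "p \<in> U" for p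
      using has_derivative_in_compose2[where g = g and g' = g' and t = V, OF g'(1) im that f'(1)[OF that]]
      by simp
  next
    fix v
    \<comment> \<open>Both the point and the direction in \<open>g' (f p) (f' p v)\<close> vary with
      \<open>p\<close>, which the induction hypothesis does not cover. Expanding the direction over
      \<open>Basis\<close> leaves products of scalar functions with \<open>g' (f p) b\<close> for
      fixed \<open>b\<close>.\<close>
    have lin: "g' (f p) (f' p v) = (\<Sum>b\<in>Basis. (f' p v \<bullet> b) *\<^sub>R g' (f p) b)" if "p \<in> U" for p
    proof -
      have "linear (g' (f p))" using g'(1) im that has_derivative_linear by blast
      then have "g' (f p) (\<Sum>b\<in>Basis. (f' p v \<bullet> b) *\<^sub>R b) = (\<Sum>b\<in>Basis. (f' p v \<bullet> b) *\<^sub>R g' (f p) b)"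
        by (simp add: linear_sum linear_scale)
      then show ?thesis by (simp only: euclidean_representation)
    qed
    have "Fk_on k U (\<lambda>p. \<Sum>b\<in>Basis. (f' p v \<bullet> b) *\<^sub>R g' (f p) b)"
      by (intro Fk_on_sum Fk_on_scaleR Fk_on_inner Fk_on_const Suc.IH f'(2) g'(2) f)
    then show "Fk_on k U (\<lambda>p. g' (f p) (f' p v))"
      using Fk_on_cong[of U "\<lambda>p. g' (f p) (f' p v)"] lin by auto
  qed
qed

lemma Fk_on_dir_deriv:
  assumes "subspace W" "openin (top_of_set W) U" "Fk_on (Suc k) U f" "v \<in> W"
  shows "Fk_on k U (\<lambda>p. dir_deriv f p v)"
proof -
  obtain f' where f': "\<And>p. p \<in> U \<Longrightarrow> (f has_derivative f' p) (at p within U)"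
    "\<And>v. Fk_on k U (\<lambda>p. f' p v)" using assms(3) by (metis Fk_on_SucE)
  have "dir_deriv f p v = f' p v" if "p \<in> U" for p
    using has_derivative_imp_dir_deriv[OF assms(1,2) that assms(4) f'(1)[OF that]] .
  then show ?thesis using Fk_on_cong[of U "\<lambda>p. dir_deriv f p v"] f'(2) by simp
qed

lemma Fk_on_line_derivative:
  assumes "subspace W" "openin (top_of_set W) U" "Fk_on (Suc k) U f" "p \<in> U" "v \<in> W"
  shows "((\<lambda>t. f (p + t *\<^sub>R v)) has_vector_derivative dir_deriv f p v) (at 0)"
proof -
  obtain f' where f': "(f has_derivative f') (at p within U)"
    using assms(3,4) by (metis Fk_on_SucE)
  show ?thesis using has_derivative_imp_line_derivative[OF assms(1,2,4,5) f']
      has_derivative_imp_dir_deriv[OF assms(1,2,4,5) f'] by simp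
qed

lemma Fk_on_dir_deriv_linear:
  assumes W: "subspace W" "openin (top_of_set W) U" and "Fk_on (Suc k) U f" "p \<in> U"
  shows "\<exists>L. linear L \<and> (\<forall>v\<in>W. dir_deriv f p v = L v)"
proof -
  obtain f' where f': "(f has_derivative f') (at p within U)"
    using assms(3,4) by (metis Fk_on_SucE)
  then show ?thesis
    using has_derivative_imp_dir_deriv[OF W assms(4) _ f'] has_derivative_linear by blast
qed

section \<open>Derivatives along curves\<close>

lemma Fk_on_curve_derivative:
  assumes W: "subspace W" "openin (top_of_set W) U" and f: "Fk_on (Suc k) U f"
    and g: "\<gamma> ` I \<subseteq> U" "(\<gamma> has_vector_derivative d) (at t within I)" "t \<in> I" "d \<in> W"
  shows "((\<lambda>s. f (\<gamma> s)) has_vector_derivative dir_deriv f (\<gamma> t) d) (at t within I)"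
proof -
  have p: "\<gamma> t \<in> U" using g by auto
  obtain f' where f': "(f has_derivative f') (at (\<gamma> t) within U)"
    using f p by (metis Fk_on_SucE)
  have "((f \<circ> \<gamma>) has_vector_derivative f' d) (at t within I)"
    using vector_derivative_diff_chain_within[OF g(2) has_derivative_subset[OF f' g(1)]] .
  then show ?thesis using has_derivative_imp_dir_deriv[OF W p g(4) f'] by (simp add: o_def)
qed

text \<open>Product rule for a differential applied to a vector field along a curve. With
  \<open>Y\<close> the velocity it yields the second derivative of the image curve; with
  \<open>Y\<close> a covariant derivative of a constant field it yields the terms of the
  curvature.\<close>

lemma Fk_on_curve_derivative_field:
  fixes f :: "'a::euclidean_space \<Rightarrow> 'b::real_normed_vector"
  assumes W: "subspace W" "openin (top_of_set W) U" and f: "Fk_on (Suc (Suc k)) U f"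
    and g: "\<gamma> ` I \<subseteq> U" "(\<gamma> has_vector_derivative d) (at t within I)" "t \<in> I" "d \<in> W"
    and Y: "Y ` I \<subseteq> W" "(Y has_vector_derivative e) (at t within I)" "e \<in> W"
  shows "((\<lambda>s. dir_deriv f (\<gamma> s) (Y s)) has_vector_derivative
      dir_deriv f (\<gamma> t) e + dir_deriv (\<lambda>q. dir_deriv f q (Y t)) (\<gamma> t) d) (at t within I)"
proof -
  have p: "\<gamma> t \<in> U" and Yt: "Y t \<in> W" using g Y by auto
  obtain f' where f': "\<And>p. p \<in> U \<Longrightarrow> (f has_derivative f' p) (at p within U)"
    "\<And>v. Fk_on (Suc k) U (\<lambda>p. f' p v)" using f by (metis Fk_on_SucE)
  \<comment> \<open>The vectors of \<open>Basis\<close> need not lie in \<open>W\<close>, so the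
    expansion is made for \<open>f'\<close> and not for \<open>dir_deriv f\<close>; \<open>D\<close>
    translates back when the argument is in \<open>W\<close>.\<close>
  have lin: "f' q v = (\<Sum>b\<in>Basis. (v \<bullet> b) *\<^sub>R f' q b)" if "q \<in> U" for q v
  proof -
    have "linear (f' q)" using f'(1) that has_derivative_linear by blast
    then have "f' q (\<Sum>b\<in>Basis. (v \<bullet> b) *\<^sub>R b) = (\<Sum>b\<in>Basis. (v \<bullet> b) *\<^sub>R f' q b)"
      by (simp add: linear_sum linear_scale)
    then show ?thesis by (simp only: euclidean_representation)
  qed
  have D: "dir_deriv f q v = f' q v" if "q \<in> U" "v \<in> W" for q v
    using has_derivative_imp_dir_deriv[OF W that f'(1)[OF that(1)]] .
  let ?H = "\<lambda>b. dir_deriv (\<lambda>q. f' q b) (\<gamma> t) d"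
  have "((\<lambda>s. \<Sum>b\<in>Basis. (Y s \<bullet> b) *\<^sub>R f' (\<gamma> s) b) has_vector_derivative
      (\<Sum>b\<in>Basis. (Y t \<bullet> b) *\<^sub>R ?H b + (e \<bullet> b) *\<^sub>R f' (\<gamma> t) b)) (at t within I)"
    by (intro has_vector_derivative_sum
        bounded_bilinear.has_vector_derivative[OF bounded_bilinear_scaleR]
        bounded_linear.has_vector_derivative[OF bounded_linear_inner_left] Y(2)
        Fk_on_curve_derivative[OF W f'(2) g])
  then have 1: "((\<lambda>s. dir_deriv f (\<gamma> s) (Y s)) has_vector_derivative
      (\<Sum>b\<in>Basis. (Y t \<bullet> b) *\<^sub>R ?H b + (e \<bullet> b) *\<^sub>R f' (\<gamma> t) b)) (at t within I)"
    by (rule has_vector_derivative_transform[rotated 2])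
      (use g Y D lin in \<open>auto simp: image_subset_iff\<close>)
  \<comment> \<open>The same sum with the field frozen at \<open>Y t\<close>: its derivative along
    \<open>d\<close> is the second summand of the claim.\<close>
  have "((\<lambda>s. \<Sum>b\<in>Basis. (Y t \<bullet> b) *\<^sub>R f' (\<gamma> t + s *\<^sub>R d) b) has_vector_derivative
      (\<Sum>b\<in>Basis. (Y t \<bullet> b) *\<^sub>R ?H b)) (at 0)"
    by (intro has_vector_derivative_sum bounded_linear.has_vector_derivative[OF bounded_linear_scaleR_right]
        Fk_on_line_derivative[OF W f'(2) p g(4)])
  then have "dir_deriv (\<lambda>q. \<Sum>b\<in>Basis. (Y t \<bullet> b) *\<^sub>R f' q b) (\<gamma> t) d = (\<Sum>b\<in>Basis. (Y t \<bullet> b) *\<^sub>R ?H b)"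
    unfolding dir_deriv_def by (rule vector_derivative_at)
  moreover have "dir_deriv (\<lambda>q. dir_deriv f q (Y t)) (\<gamma> t) d =
      dir_deriv (\<lambda>q. \<Sum>b\<in>Basis. (Y t \<bullet> b) *\<^sub>R f' q b) (\<gamma> t) d"
    by (rule dir_deriv_cong[OF W p g(4)]) (rule trans[OF D[OF _ Yt] lin])
  moreover have "(\<Sum>b\<in>Basis. (Y t \<bullet> b) *\<^sub>R ?H b + (e \<bullet> b) *\<^sub>R f' (\<gamma> t) b) =
      dir_deriv f (\<gamma> t) e + (\<Sum>b\<in>Basis. (Y t \<bullet> b) *\<^sub>R ?H b)"
    by (simp only: D[OF p Y(3)] lin[OF p, of e] sum.distrib add.commute)
  ultimately show ?thesis using 1 by simp
qed

text \<open>
  Symmetry of second derivatives: the second difference of \<open>f\<close> over a small square is computed by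
  the mean value theorem in both orders.
\<close>

lemma rectangle_mean_value:
  fixes h hx hxy :: "real \<Rightarrow> real \<Rightarrow> real"
  assumes "0 < s"
    and "\<And>a b. a \<in> {0..s} \<Longrightarrow> b \<in> {0..s} \<Longrightarrow> ((\<lambda>a. h a b) has_real_derivative hx a b) (at a)"
    and "\<And>a b. a \<in> {0..s} \<Longrightarrow> b \<in> {0..s} \<Longrightarrow> ((\<lambda>b. hx a b) has_real_derivative hxy a b) (at b)"
  obtains a b where "a \<in> {0..s}" "b \<in> {0..s}" "h s s - h s 0 - h 0 s + h 0 0 = s * s * hxy a b"
proof -
  have "\<exists>a>0. a < s \<and> (h s s - h s 0) - (h 0 s - h 0 0) = (s - 0) * (hx a s - hx a 0)"
    by (rule MVT2) (use assms in \<open>auto intro!: DERIV_diff\<close>)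
  then obtain a where a: "0 < a" "a < s" "(h s s - h s 0) - (h 0 s - h 0 0) = s * (hx a s - hx a 0)"
    by auto
  have "\<exists>b>0. b < s \<and> hx a s - hx a 0 = (s - 0) * hxy a b"
    by (rule MVT2) (use assms a in auto)
  then obtain b where "0 < b" "b < s" "hx a s - hx a 0 = s * hxy a b" by auto
  with a show ?thesis by (intro that[of a b]) auto
qed

lemma second_difference_dir_deriv:
  fixes f :: "'a::real_normed_vector \<Rightarrow> real"
  assumes W: "subspace W" "openin (top_of_set W) U" and f: "Fk_on (Suc (Suc k)) U f"
    and v: "v \<in> W" and w: "w \<in> W" and "0 < s"
    and box: "\<And>a b. a \<in> {0..s} \<Longrightarrow> b \<in> {0..s} \<Longrightarrow> p + a *\<^sub>R v + b *\<^sub>R w \<in> U"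
  obtains a b where "a \<in> {0..s}" "b \<in> {0..s}"
    "f (p + s *\<^sub>R v + s *\<^sub>R w) - f (p + s *\<^sub>R v) - f (p + s *\<^sub>R w) + f p =
      s * s * dir_deriv (\<lambda>q. dir_deriv f q v) (p + a *\<^sub>R v + b *\<^sub>R w) w"
proof -
  \<comment> \<open>Differentiating at \<open>t\<close> amounts to differentiating at 0 from the
    shifted base point \<open>q + t *\<^sub>R u\<close>.\<close>
  have shift: "((\<lambda>t. F (q + t *\<^sub>R u)) has_real_derivative dir_deriv F (q + t *\<^sub>R u) u) (at t)"
    if "Fk_on (Suc k') U F" "q + t *\<^sub>R u \<in> U" "u \<in> W" for F :: "'a \<Rightarrow> real" and q t u k'
    using Fk_on_line_derivative[OF W that]
      DERIV_shift[of "\<lambda>t. F (q + t *\<^sub>R u)" _ 0 t]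
    by (simp add: has_real_derivative_iff_has_vector_derivative algebra_simps)
  have fv: "Fk_on (Suc k) U (\<lambda>q. dir_deriv f q v)" by (rule Fk_on_dir_deriv[OF W f v])
  show ?thesis
  proof (rule rectangle_mean_value[OF \<open>0 < s\<close>, where h = "\<lambda>a b. f (p + a *\<^sub>R v + b *\<^sub>R w)"])
    show "((\<lambda>a. f (p + a *\<^sub>R v + b *\<^sub>R w)) has_real_derivative dir_deriv f (p + a *\<^sub>R v + b *\<^sub>R w) v) (at a)"
      if "a \<in> {0..s}" "b \<in> {0..s}" for a b
      using shift[OF f, of "p + b *\<^sub>R w" a v] box[OF that] v by (simp add: algebra_simps)
    show "((\<lambda>b. dir_deriv f (p + a *\<^sub>R v + b *\<^sub>R w) v) has_real_derivative
        dir_deriv (\<lambda>q. dir_deriv f q v) (p + a *\<^sub>R v + b *\<^sub>R w) w) (at b)"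
      if "a \<in> {0..s}" "b \<in> {0..s}" for a b
      using shift[OF fv _ w] box[OF that] by simp
  qed (use that in auto)
qed

lemma dir_deriv_commute_real:
  fixes f :: "'a::real_normed_vector \<Rightarrow> real"
  assumes W: "subspace W" "openin (top_of_set W) U" and f: "Fk_on (Suc (Suc k)) U f"
    and p: "p \<in> U" and v: "v \<in> W" and w: "w \<in> W"
  shows "dir_deriv (\<lambda>q. dir_deriv f q w) p v = dir_deriv (\<lambda>q. dir_deriv f q v) p w"
proof (rule ccontr)
  let ?A = "\<lambda>q. dir_deriv (\<lambda>q. dir_deriv f q w) q v" and ?B = "\<lambda>q. dir_deriv (\<lambda>q. dir_deriv f q v) q w"
  assume "?A p \<noteq> ?B p"
  \<comment> \<open>Half the supposed gap: a number closer than \<open>e\<close> to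
    \<open>?A p\<close> cannot also be closer than \<open>e\<close> to \<open>?B p\<close>.\<close>
  define e where "e = \<bar>?A p - ?B p\<bar> / 2"
  have e: "e > 0" using \<open>?A p \<noteq> ?B p\<close> by (simp add: e_def)
  have "continuous_on U ?A" "continuous_on U ?B"
    using Fk_on_dir_deriv[OF W Fk_on_dir_deriv[OF W f]] v w Fk_on_imp_continuous_on by blast+
  then obtain d1 d2 where d1: "d1 > 0" "\<And>q. q \<in> U \<Longrightarrow> dist q p < d1 \<Longrightarrow> dist (?A q) (?A p) < e"
    and d2: "d2 > 0" "\<And>q. q \<in> U \<Longrightarrow> dist q p < d2 \<Longrightarrow> dist (?B q) (?B p) < e"
    using p e unfolding continuous_on_iff by metis
  obtain d3 where d3: "d3 > 0" "\<And>q. q \<in> W \<Longrightarrow> dist q p < d3 \<Longrightarrow> q \<in> U"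
    using W(2) p unfolding openin_euclidean_subtopology_iff by metis
  define d where "d = Min {d1, d2, d3}"
  have d: "d > 0" "d \<le> d1" "d \<le> d2" "d \<le> d3" using d1 d2 d3 by (auto simp: d_def)
  \<comment> \<open>The summand 1 keeps \<open>N\<close> positive if both vectors vanish. The side
    length \<open>s\<close> keeps the whole parallelogram within distance \<open>d / 2\<close> of
    \<open>p\<close>.\<close>
  define N where "N = norm v + norm w + 1"
  have N: "N > 0" by (simp add: N_def add_nonneg_pos)
  define s where "s = d / (2 * N)"
  have s: "s > 0" using d N by (simp add: s_def)
  have near: "dist (p + a *\<^sub>R v + b *\<^sub>R w) p < d" if "a \<in> {0..s}" "b \<in> {0..s}" for a b
  proof -
    have "norm (a *\<^sub>R v + b *\<^sub>R w) \<le> s * norm v + s * norm w"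
      using that by (intro norm_triangle_mono) (auto intro: mult_right_mono)
    also have "\<dots> \<le> s * N" using s by (simp add: N_def algebra_simps)
    also have "\<dots> = d / 2" using N by (simp add: s_def)
    finally show ?thesis using d by (simp add: dist_norm add.assoc)
  qed
  have pW: "p \<in> W" using W(2) p openin_imp_subset by blast
  have box: "p + a *\<^sub>R v + b *\<^sub>R w \<in> U" if "a \<in> {0..s}" "b \<in> {0..s}" for a b
  proof (rule d3(2))
    show "p + a *\<^sub>R v + b *\<^sub>R w \<in> W" by (intro subspace_add subspace_scale W(1) pW v w)
    show "dist (p + a *\<^sub>R v + b *\<^sub>R w) p < d3" using near[OF that] d(4) by linarith
  qed
  obtain a b where ab: "a \<in> {0..s}" "b \<in> {0..s}"
    "f (p + s *\<^sub>R v + s *\<^sub>R w) - f (p + s *\<^sub>R v) - f (p + s *\<^sub>R w) + f p = s * s * ?B (p + a *\<^sub>R v + b *\<^sub>R w)"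
    by (rule second_difference_dir_deriv[OF W f v w s box])
  have box': "p + a *\<^sub>R w + b *\<^sub>R v \<in> U" if "a \<in> {0..s}" "b \<in> {0..s}" for a b
    using box[OF that(2,1)] by (simp add: algebra_simps)
  obtain b' a' where ab': "b' \<in> {0..s}" "a' \<in> {0..s}"
    "f (p + s *\<^sub>R w + s *\<^sub>R v) - f (p + s *\<^sub>R w) - f (p + s *\<^sub>R v) + f p = s * s * ?A (p + b' *\<^sub>R w + a' *\<^sub>R v)"
    by (rule second_difference_dir_deriv[OF W f w v s box'])
  have "s * s * ?B (p + a *\<^sub>R v + b *\<^sub>R w) = s * s * ?A (p + b' *\<^sub>R w + a' *\<^sub>R v)"
    using ab(3) ab'(3) by (simp add: algebra_simps)
  then have eq: "?B (p + a *\<^sub>R v + b *\<^sub>R w) = ?A (p + a' *\<^sub>R v + b' *\<^sub>R w)" using s by (simp add: algebra_simps)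
  have "dist (?B (p + a *\<^sub>R v + b *\<^sub>R w)) (?B p) < e"
    using d2(2)[OF box[OF ab(1,2)]] near[OF ab(1,2)] d by linarith
  moreover have "dist (?A (p + a' *\<^sub>R v + b' *\<^sub>R w)) (?A p) < e"
    using d1(2)[OF box[OF ab'(2,1)]] near[OF ab'(2,1)] d by linarith
  ultimately show False using eq by (simp add: e_def dist_real_def abs_if split: if_splits)
qed

text \<open>Taking the inner product with a fixed vector commutes with directional differentiation,
  and these products separate points; this reduces the claim to real functions.\<close>

lemma dir_deriv_commute:
  fixes f :: "'a::real_normed_vector \<Rightarrow> 'b::real_inner"
  assumes W: "subspace W" "openin (top_of_set W) U" and f: "Fk_on (Suc (Suc k)) U f"
    and p: "p \<in> U" and v: "v \<in> W" and w: "w \<in> W"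
  shows "dir_deriv (\<lambda>q. dir_deriv f q w) p v = dir_deriv (\<lambda>q. dir_deriv f q v) p w"
proof -
  have comp: "dir_deriv (\<lambda>q. F q \<bullet> u) q x = dir_deriv F q x \<bullet> u"
    if "Fk_on (Suc k') U F" "q \<in> U" "x \<in> W" for F :: "'a \<Rightarrow> 'b" and k' q x u
    unfolding dir_deriv_def[of "\<lambda>q. F q \<bullet> u"]
    by (intro vector_derivative_at bounded_linear.has_vector_derivative[OF bounded_linear_inner_left]
        Fk_on_line_derivative[OF W that])
  have second: "dir_deriv (\<lambda>q. dir_deriv (\<lambda>q. f q \<bullet> u) q x) p y = dir_deriv (\<lambda>q. dir_deriv f q x) p y \<bullet> u"
    if "x \<in> W" "y \<in> W" for x y u
  proof -
    have "dir_deriv (\<lambda>q. dir_deriv (\<lambda>q. f q \<bullet> u) q x) p y = dir_deriv (\<lambda>q. dir_deriv f q x \<bullet> u) p y"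
      using comp[OF f _ that(1)] by (intro dir_deriv_cong[OF W p that(2)]) auto
    also have "\<dots> = dir_deriv (\<lambda>q. dir_deriv f q x) p y \<bullet> u"
      by (rule comp[OF Fk_on_dir_deriv[OF W f that(1)] p that(2)])
    finally show ?thesis .
  qed
  have "dir_deriv (\<lambda>q. dir_deriv f q w) p v \<bullet> u = dir_deriv (\<lambda>q. dir_deriv f q v) p w \<bullet> u" for u
    using dir_deriv_commute_real[OF W Fk_on_inner[OF f Fk_on_const] p v w, of u] second v w by simp
  then show ?thesis using vector_eq_rdot by blast
qed

text \<open>For \<open>u\<close> orthogonal to \<open>W\<close> the function
  \<open>u \<bullet> \<gamma> s\<close> is zero on \<open>I\<close>, so \<open>d\<close> is
  orthogonal to \<open>u\<close> and lies in the double orthogonal complement, which is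
  \<open>W\<close>. The limit point condition makes the derivative within \<open>I\<close>
  unique.\<close>

lemma has_vector_derivative_in_subspace:
  fixes \<gamma> :: "real \<Rightarrow> 'a::euclidean_space"
  assumes W: "subspace W" and "\<gamma> ` I \<subseteq> W" "(\<gamma> has_vector_derivative d) (at t within I)" "t islimpt I" "t \<in> I"
  shows "d \<in> W"
proof -
  have "u \<bullet> d = 0" if u: "u \<in> W\<^sup>\<bottom>" for u
  proof -
    have "((\<lambda>s. u \<bullet> \<gamma> s) has_vector_derivative u \<bullet> d) (at t within I)"
      by (intro bounded_linear.has_vector_derivative[OF bounded_linear_inner_right] assms)
    moreover have "u \<bullet> \<gamma> s = 0" if "s \<in> I" for s
      using u assms(2) that inner_commute[of u "\<gamma> s"]
      by (auto simp: orthogonal_comp_def orthogonal_def image_subset_iff)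
    then have "((\<lambda>s. u \<bullet> \<gamma> s) has_vector_derivative 0) (at t within I)"
      by (intro has_vector_derivative_transform[OF assms(5) _ has_vector_derivative_const]) auto
    ultimately show ?thesis
      using assms(4) vector_derivative_unique_within trivial_limit_within by blast
  qed
  then have "d \<in> W\<^sup>\<bottom>\<^sup>\<bottom>" by (auto simp: orthogonal_comp_def orthogonal_def)
  then show ?thesis using orthogonal_comp_self[OF W] by simp
qed

lemma affine_if_zero_second_derivative:
  fixes c :: "real \<Rightarrow> 'a::real_normed_vector"
  assumes I: "is_interval I"
    and c: "\<And>t. t \<in> I \<Longrightarrow> (c has_vector_derivative c1 t) (at t within I)"
      "\<And>t. t \<in> I \<Longrightarrow> (c1 has_vector_derivative 0) (at t within I)"
  obtains a b where "\<And>t. t \<in> I \<Longrightarrow> c t = a + t *\<^sub>R b"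
proof -
  have cv: "convex I" using I by (rule is_interval_convex)
  obtain b where b: "\<And>t. t \<in> I \<Longrightarrow> c1 t = b"
    using has_derivative_zero_constant[OF cv, of c1] c(2) by (auto simp: has_vector_derivative_def)
  have "((\<lambda>t. c t - t *\<^sub>R b) has_vector_derivative c1 t - 1 *\<^sub>R b) (at t within I)" if "t \<in> I" for t
    by (intro has_vector_derivative_diff c that
        bounded_linear.has_vector_derivative[OF bounded_linear_scaleR_left] has_vector_derivative_id)
  then obtain a where "\<And>t. t \<in> I \<Longrightarrow> c t - t *\<^sub>R b = a"
    using has_derivative_zero_constant[OF cv, of "\<lambda>t. c t - t *\<^sub>R b"] b
    by (auto simp: has_vector_derivative_def)
  then show ?thesis by (intro that[of a b]) (metis diff_add_cancel)
qed

section \<open>Metrics pulled back from a Euclidean space\<close>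

text \<open>The inverse \<open>K\<close> is defined on the whole target, so every affine line comes
  from a curve in \<open>U\<close>. The locale is instantiated twice, for the cone in
  \<open>V_space\<close> and for the ambient cone, so that totally geodesic becomes a comparison of
  two charts.\<close>

locale flat_chart =
  fixes U W :: "'a::euclidean_space set" and F :: "'a \<Rightarrow> 'b::euclidean_space" and K :: "'b \<Rightarrow> 'a"
    and g :: "'a metric_tensor"
  assumes subspace_W: "subspace W" and openin_U: "openin (top_of_set W) U"
    and smooth_F: "\<And>k. Fk_on k U F" and smooth_K: "\<And>k. Fk_on k UNIV K"
    and K_in_U: "\<And>y. K y \<in> U" and F_K [simp]: "\<And>y. F (K y) = y"
    and K_F [simp]: "\<And>p. p \<in> U \<Longrightarrow> K (F p) = p"
    and metric_eq: "\<And>p v w. p \<in> U \<Longrightarrow> v \<in> W \<Longrightarrow> w \<in> W \<Longrightarrow>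
      g p v w = dir_deriv F p v \<bullet> dir_deriv F p w"
begin

abbreviation "D \<equiv> dir_deriv F"
abbreviation "E \<equiv> dir_deriv K"

definition hess :: "'a \<Rightarrow> 'a \<Rightarrow> 'a \<Rightarrow> 'b" where
  "hess p v w = dir_deriv (\<lambda>q. D q w) p v"

definition connection :: "'a \<Rightarrow> 'a \<Rightarrow> 'a \<Rightarrow> 'a" where
  "connection p v w = E (F p) (hess p v w)"

lemma U_subset_W: "U \<subseteq> W"
  using openin_U openin_imp_subset by blast

lemma inv_into_F: "inv_into U F = K"
proof
  fix y
  have "inj_on F U" by (metis K_F inj_onI)
  then show "inv_into U F y = K y" using inv_into_f_eq[of F U "K y" y] K_in_U by simp
qed

lemma bij_F: "bij_betw F U UNIV"
  by (rule bij_betwI[where g = K]) (auto intro: K_in_U)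

lemma Fk_on_D: "v \<in> W \<Longrightarrow> Fk_on k U (\<lambda>p. D p v)"
  by (rule Fk_on_dir_deriv[OF subspace_W openin_U smooth_F])

lemma Fk_on_hess: "v \<in> W \<Longrightarrow> w \<in> W \<Longrightarrow> Fk_on k U (\<lambda>p. hess p v w)"
  unfolding hess_def by (rule Fk_on_dir_deriv[OF subspace_W openin_U Fk_on_D])

lemma D_linear: "p \<in> U \<Longrightarrow> \<exists>L. linear L \<and> (\<forall>v\<in>W. D p v = L v)"
  by (rule Fk_on_dir_deriv_linear[OF subspace_W openin_U smooth_F])

lemma D_add: "p \<in> U \<Longrightarrow> v \<in> W \<Longrightarrow> w \<in> W \<Longrightarrow> D p (v + w) = D p v + D p w"
  using D_linear[of p] by (auto simp: linear_add subspace_add[OF subspace_W])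

lemma D_scaleR: "p \<in> U \<Longrightarrow> v \<in> W \<Longrightarrow> D p (c *\<^sub>R v) = c *\<^sub>R D p v"
  using D_linear[of p] by (auto simp: linear_scale subspace_scale[OF subspace_W])

lemma line_K:
  "((\<lambda>t. K (y + t *\<^sub>R u)) has_vector_derivative E (y + t *\<^sub>R u) u) (at t)"
  by (rule Fk_on_curve_derivative[OF subspace_UNIV _ smooth_K, where \<gamma> = "\<lambda>t. y + t *\<^sub>R u" and I = UNIV])
    (auto intro!: derivative_eq_intros)

lemma E_in_W: "E y u \<in> W"
  by (rule has_vector_derivative_in_subspace[OF subspace_W, where I = UNIV and t = 0
        and \<gamma> = "\<lambda>t. K (y + t *\<^sub>R u)"])
    (use line_K[of y u 0] K_in_U U_subset_W in \<open>auto simp: islimpt_UNIV\<close>)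

lemma D_E: "D (K y) (E y u) = u"
proof -
  have "((\<lambda>t. F (K (y + t *\<^sub>R u))) has_vector_derivative D (K (y + 0 *\<^sub>R u)) (E (y + 0 *\<^sub>R u) u)) (at 0)"
    by (rule Fk_on_curve_derivative[OF subspace_W openin_U smooth_F _ line_K])
      (use K_in_U E_in_W in auto)
  moreover have "((\<lambda>t. F (K (y + t *\<^sub>R u))) has_vector_derivative u) (at 0)"
    by (auto intro!: derivative_eq_intros)
  ultimately show ?thesis using vector_derivative_unique_at by fastforce
qed

lemma D_E_F [simp]: "p \<in> U \<Longrightarrow> D p (E (F p) u) = u"
  using D_E[of "F p" u] by simp

lemma line_F: "p \<in> U \<Longrightarrow> v \<in> W \<Longrightarrow> ((\<lambda>t. F (p + t *\<^sub>R v)) has_vector_derivative D p v) (at 0)"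
  by (rule Fk_on_line_derivative[OF subspace_W openin_U smooth_F])

lemma E_D:
  assumes p: "p \<in> U" and v: "v \<in> W"
  shows "E (F p) (D p v) = v"
proof -
  have "((\<lambda>t. K (F (p + t *\<^sub>R v))) has_vector_derivative E (F (p + 0 *\<^sub>R v)) (D p v)) (at 0)"
    by (rule Fk_on_curve_derivative[OF subspace_UNIV _ smooth_K, where I = UNIV])
      (use line_F[OF p v] in auto)
  also have "?this \<longleftrightarrow> ((\<lambda>t. p + t *\<^sub>R v) has_vector_derivative E (F (p + 0 *\<^sub>R v)) (D p v)) (at 0)"
    by (rule line_has_vector_derivative_cong[OF subspace_W openin_U p v]) simp
  finally have "((\<lambda>t. p + t *\<^sub>R v) has_vector_derivative E (F p) (D p v)) (at 0)" by simp
  moreover have "((\<lambda>t. p + t *\<^sub>R v) has_vector_derivative v) (at 0)"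
    by (auto intro!: derivative_eq_intros)
  ultimately show ?thesis by (rule vector_derivative_unique_at)
qed

lemma D_inj: "p \<in> U \<Longrightarrow> v \<in> W \<Longrightarrow> w \<in> W \<Longrightarrow> D p v = D p w \<Longrightarrow> v = w"
  by (metis E_D)

lemma D_zero: "p \<in> U \<Longrightarrow> D p 0 = 0"
  using D_scaleR[of p 0 0] subspace_0[OF subspace_W] by simp

lemma hess_commute: "p \<in> U \<Longrightarrow> v \<in> W \<Longrightarrow> w \<in> W \<Longrightarrow> hess p v w = hess p w v"
  unfolding hess_def by (rule dir_deriv_commute[OF subspace_W openin_U smooth_F])

lemma connection_in_W: "connection p v w \<in> W"
  by (simp add: connection_def E_in_W)

lemma D_connection: "p \<in> U \<Longrightarrow> D p (connection p v w) = hess p v w"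
  by (simp add: connection_def)

section \<open>The Koszul formula and the Levi-Civita connection\<close>

lemma dir_deriv_metric:
  assumes p: "p \<in> U" and "v \<in> W" "w \<in> W" "z \<in> W"
  shows "dir_deriv (\<lambda>q. g q w z) p v = D p w \<bullet> hess p v z + hess p v w \<bullet> D p z"
proof -
  have "dir_deriv (\<lambda>q. g q w z) p v = dir_deriv (\<lambda>q. D q w \<bullet> D q z) p v"
    using assms by (intro dir_deriv_cong[OF subspace_W openin_U]) (auto simp: metric_eq)
  also have "((\<lambda>t. D (p + t *\<^sub>R v) w \<bullet> D (p + t *\<^sub>R v) z) has_vector_derivative
      D (p + 0 *\<^sub>R v) w \<bullet> hess p v z + hess p v w \<bullet> D (p + 0 *\<^sub>R v) z) (at 0)"
    unfolding hess_def
    by (intro bounded_bilinear.has_vector_derivative[OF bounded_bilinear_inner]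
        Fk_on_line_derivative[OF subspace_W openin_U Fk_on_D] assms)
  then have "dir_deriv (\<lambda>q. D q w \<bullet> D q z) p v = D p w \<bullet> hess p v z + hess p v w \<bullet> D p z"
    unfolding dir_deriv_def[of "\<lambda>q. D q w \<bullet> D q z"] using vector_derivative_at by fastforce
  finally show ?thesis .
qed

text \<open>The three Koszul terms expand to six products of \<open>D\<close> with
  \<open>hess\<close>. By symmetry of \<open>hess\<close> four of them cancel and the other two
  coincide.\<close>

lemma christoffel_eq:
  assumes p: "p \<in> U" and v: "v \<in> W" and w: "w \<in> W"
  shows "christoffel W g p v w = connection p v w"
  unfolding christoffel_def
proof (rule the_equality)
  have koszul: "dir_deriv (\<lambda>q. g q w z) p v + dir_deriv (\<lambda>q. g q v z) p w - dir_deriv (\<lambda>q. g q v w) p z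
      = 2 * (hess p v w \<bullet> D p z)" if z: "z \<in> W" for z
    using dir_deriv_metric[OF p v w z] dir_deriv_metric[OF p w v z] dir_deriv_metric[OF p z v w]
      hess_commute[OF p v w] hess_commute[OF p v z] hess_commute[OF p w z]
    by (simp add: inner_commute)
  show "connection p v w \<in> W \<and> (\<forall>z\<in>W. 2 * g p (connection p v w) z = dir_deriv (\<lambda>q. g q w z) p v
      + dir_deriv (\<lambda>q. g q v z) p w - dir_deriv (\<lambda>q. g q v w) p z)"
    using koszul p by (simp add: connection_in_W metric_eq D_connection)
  fix c
  assume c: "c \<in> W \<and> (\<forall>z\<in>W. 2 * g p c z = dir_deriv (\<lambda>q. g q w z) p v
      + dir_deriv (\<lambda>q. g q v z) p w - dir_deriv (\<lambda>q. g q v w) p z)"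
  \<comment> \<open>The test vector \<open>E (F p) u\<close> lies in \<open>W\<close> and is sent to
    \<open>u\<close> by \<open>D p\<close>, so testing on \<open>W\<close> determines
    \<open>D p c\<close> completely.\<close>
  have "D p c \<bullet> u = hess p v w \<bullet> u" for u
  proof -
    have "2 * g p c (E (F p) u) = 2 * (hess p v w \<bullet> D p (E (F p) u))"
      using c koszul[OF E_in_W] E_in_W[of "F p" u] by metis
    then show ?thesis using metric_eq[OF p _ E_in_W[of "F p" u], of c] c p by simp
  qed
  then have "D p c = hess p v w" using vector_eq_rdot by blast
  then show "c = connection p v w"
    using c D_inj[OF p] connection_in_W D_connection[OF p] by metis
qed

lemma riemannian_metric: "riemannian_metric_on U W g"
  unfolding riemannian_metric_on_def
proof (intro conjI ballI allI impI)
  fix v w assume v: "v \<in> W" and w: "w \<in> W"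
  show "smooth_map_on U W (\<lambda>p. g p v w)"
    unfolding smooth_map_on_def
  proof
    fix k
    have "Fk_on k U (\<lambda>p. D p v \<bullet> D p w)" by (intro Fk_on_inner Fk_on_D v w)
    then show "Ck_on k U W (\<lambda>p. g p v w)"
      using Fk_on_cong[of U "\<lambda>p. g p v w"] metric_eq v w
      by (intro Fk_on_imp_Ck_on[OF subspace_W openin_U]) auto
  qed
next
  fix p v assume "p \<in> U" "v \<in> W" "v \<noteq> 0"
  then show "0 < g p v v"
    using D_inj[of p v 0] D_zero[of p] subspace_0[OF subspace_W] by (auto simp: metric_eq)
qed (auto simp: subspace_W openin_U metric_eq D_add D_scaleR inner_add_left
      subspace_add[OF subspace_W] subspace_scale[OF subspace_W] intro: inner_commute)

lemma isometry: "riemannian_isometry U W g UNIV UNIV standard_metric F"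
proof -
  have "smooth_map_on UNIV UNIV (\<lambda>p. standard_metric p v w)" for v w :: 'b
    unfolding standard_metric_def smooth_map_on_def
    by (auto intro: Fk_on_imp_Ck_on Fk_on_const)
  then have "riemannian_metric_on UNIV UNIV (standard_metric :: 'b metric_tensor)"
    by (auto simp: riemannian_metric_on_def standard_metric_def inner_add_left intro: inner_commute)
  moreover have "diffeomorphism_on U W UNIV UNIV F"
    unfolding diffeomorphism_on_def smooth_map_on_def inv_into_F
    using bij_F Fk_on_imp_Ck_on[OF subspace_W openin_U smooth_F]
      Fk_on_imp_Ck_on[OF subspace_UNIV _ smooth_K] by auto
  ultimately show ?thesis
    using riemannian_metric by (simp add: riemannian_isometry_def standard_metric_def metric_eq)
qed

section \<open>Covariant derivatives and curvature\<close>

lemma Fk_on_connection: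
  assumes v: "v \<in> W" and w: "w \<in> W"
  shows "Fk_on k U (\<lambda>q. connection q v w)"
proof -
  \<comment> \<open>The argument \<open>hess q v w\<close> of \<open>E (F q)\<close> varies with
    \<open>q\<close>; linearity separates it from the coefficient functions
    \<open>E (F q) b\<close>.\<close>
  have "E y u = (\<Sum>b\<in>Basis. (u \<bullet> b) *\<^sub>R E y b)" for y u
  proof -
    obtain L where "linear L" "\<And>u. E y u = L u"
      using Fk_on_dir_deriv_linear[OF subspace_UNIV _ smooth_K, of y] by auto
    then have "E y (\<Sum>b\<in>Basis. (u \<bullet> b) *\<^sub>R b) = (\<Sum>b\<in>Basis. (u \<bullet> b) *\<^sub>R E y b)"
      by (simp add: linear_sum linear_scale)
    then show ?thesis by (simp only: euclidean_representation)
  qed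
  then have "(\<lambda>q. connection q v w) = (\<lambda>q. \<Sum>b\<in>Basis. (hess q v w \<bullet> b) *\<^sub>R E (F q) b)"
    unfolding connection_def by (rule ext)
  moreover have "Fk_on k U (\<lambda>q. E (F q) b)" for b
    by (rule Fk_on_compose[OF Fk_on_dir_deriv[OF subspace_UNIV _ smooth_K] smooth_F]) auto
  then have "Fk_on k U (\<lambda>q. \<Sum>b\<in>Basis. (hess q v w \<bullet> b) *\<^sub>R E (F q) b)"
    by (intro Fk_on_sum Fk_on_scaleR Fk_on_inner Fk_on_const Fk_on_hess v w)
  ultimately show ?thesis by simp
qed

text \<open>
  \<open>D p\<close> turns the covariant derivative of a constant field into an ordinary second derivative of
  \<open>q \<mapsto> D q z\<close>, which is symmetric in \<open>v, w\<close>; this is why the curvature vanishes.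
\<close>

lemma D_covariant_derivative:
  assumes p: "p \<in> U" and v: "v \<in> W" and w: "w \<in> W" and z: "z \<in> W"
  shows "dir_deriv (\<lambda>q. connection q w z) p v \<in> W"
    and "D p (dir_deriv (\<lambda>q. connection q w z) p v + connection p v (connection p w z)) =
      dir_deriv (\<lambda>q. dir_deriv (\<lambda>q. D q z) q w) p v"
proof -
  let ?X = "\<lambda>q. connection q w z"
  have lX: "((\<lambda>t. ?X (p + t *\<^sub>R v)) has_vector_derivative dir_deriv ?X p v) (at 0)"
    by (rule Fk_on_line_derivative[OF subspace_W openin_U Fk_on_connection[OF w z] p v])
  show W': "dir_deriv ?X p v \<in> W"
    by (rule has_vector_derivative_in_subspace[OF subspace_W _ lX])
      (auto simp: connection_in_W islimpt_UNIV)
  from eventually_line_in_openin[OF subspace_W openin_U p v] obtain d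
    where d: "d > 0" "\<And>t::real. dist t 0 < d \<Longrightarrow> t \<noteq> 0 \<Longrightarrow> p + t *\<^sub>R v \<in> U"
    by (auto simp: eventually_at)
  let ?I = "ball (0::real) d"
  have im: "(\<lambda>t. p + t *\<^sub>R v) ` ?I \<subseteq> U"
    using d(2) p by (auto simp: dist_commute) (metis add.right_neutral scaleR_zero_left)
  have at: "at 0 within ?I = at 0" using d(1) by (intro at_within_open) auto
  have "((\<lambda>t. D (p + t *\<^sub>R v) (?X (p + t *\<^sub>R v))) has_vector_derivative
      D (p + 0 *\<^sub>R v) (dir_deriv ?X p v) + dir_deriv (\<lambda>q. D q (?X (p + 0 *\<^sub>R v))) (p + 0 *\<^sub>R v) v)
      (at 0 within ?I)"
    by (rule Fk_on_curve_derivative_field[OF subspace_W openin_U smooth_F im])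
      (use d(1) v lX W' in \<open>auto simp: at connection_in_W intro!: derivative_eq_intros\<close>)
  then have 1: "((\<lambda>t. D (p + t *\<^sub>R v) (?X (p + t *\<^sub>R v))) has_vector_derivative
      D p (dir_deriv ?X p v) + hess p v (?X p)) (at 0)" by (simp add: at hess_def)
  \<comment> \<open>By \<open>D_connection\<close> the function just differentiated equals
    \<open>hess\<close> in \<open>w\<close> and \<open>z\<close> on \<open>U\<close>. This gives a
    second expression for the same derivative.\<close>
  have "((\<lambda>t. hess (p + t *\<^sub>R v) w z) has_vector_derivative dir_deriv (\<lambda>q. hess q w z) p v) (at 0)"
    by (rule Fk_on_line_derivative[OF subspace_W openin_U Fk_on_hess[OF w z] p v])
  also have "?this \<longleftrightarrow> ((\<lambda>t. D (p + t *\<^sub>R v) (?X (p + t *\<^sub>R v))) has_vector_derivative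
      dir_deriv (\<lambda>q. hess q w z) p v) (at 0)"
    by (rule line_has_vector_derivative_cong[OF subspace_W openin_U p v]) (simp add: D_connection)
  finally have "D p (dir_deriv ?X p v) + hess p v (?X p) = dir_deriv (\<lambda>q. hess q w z) p v"
    by (rule vector_derivative_unique_at[OF 1])
  then show "D p (dir_deriv ?X p v + connection p v (?X p)) =
      dir_deriv (\<lambda>q. dir_deriv (\<lambda>q. D q z) q w) p v"
    using W' p by (simp add: D_add connection_in_W D_connection hess_def)
qed

lemma flat: "flat_metric U W g"
  unfolding flat_metric_def riemann_curvature_def
proof (intro ballI)
  fix p v w z assume p: "p \<in> U" and v: "v \<in> W" and w: "w \<in> W" and z: "z \<in> W"
  have c: "dir_deriv (\<lambda>q. christoffel W g q w z) p v + christoffel W g p v (christoffel W g p w z) =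
      dir_deriv (\<lambda>q. connection q w z) p v + connection p v (connection p w z)"
    if "v \<in> W" "w \<in> W" for v w
    using dir_deriv_cong[OF subspace_W openin_U p that(1), of "\<lambda>q. christoffel W g q w z"]
      christoffel_eq that p z connection_in_W by simp
  have "dir_deriv (\<lambda>q. connection q w z) p v + connection p v (connection p w z) =
      dir_deriv (\<lambda>q. connection q v z) p w + connection p w (connection p v z)"
  proof (rule D_inj[OF p])
    show "D p (dir_deriv (\<lambda>q. connection q w z) p v + connection p v (connection p w z)) =
      D p (dir_deriv (\<lambda>q. connection q v z) p w + connection p w (connection p v z))"
      using D_covariant_derivative(2)[OF p v w z] D_covariant_derivative(2)[OF p w v z]
        dir_deriv_commute[OF subspace_W openin_U Fk_on_D[OF z] p v w] by simp
  qed (auto intro!: subspace_add[OF subspace_W] connection_in_W D_covariant_derivative(1) p v w z)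
  then show "dir_deriv (\<lambda>q. christoffel W g q w z) p v + christoffel W g p v (christoffel W g p w z)
      - (dir_deriv (\<lambda>q. christoffel W g q v z) p w + christoffel W g p w (christoffel W g p v z)) = 0"
    using c v w by simp
qed

section \<open>Geodesics as affine lines in the chart\<close>

lemma curve_second_derivative:
  assumes I: "\<gamma> ` I \<subseteq> U" "\<And>t. t \<in> I \<Longrightarrow> t islimpt I"
    and d1: "\<And>t. t \<in> I \<Longrightarrow> (\<gamma> has_vector_derivative \<gamma>1 t) (at t within I)"
    and d2: "\<And>t. t \<in> I \<Longrightarrow> (\<gamma>1 has_vector_derivative \<gamma>2 t) (at t within I)"
    and t: "t \<in> I"
  shows "\<gamma>1 t \<in> W" and "\<gamma>2 t \<in> W"
    and "((\<lambda>s. F (\<gamma> s)) has_vector_derivative D (\<gamma> t) (\<gamma>1 t)) (at t within I)"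
    and "((\<lambda>s. D (\<gamma> s) (\<gamma>1 s)) has_vector_derivative
      D (\<gamma> t) (\<gamma>2 t + christoffel W g (\<gamma> t) (\<gamma>1 t) (\<gamma>1 t))) (at t within I)"
proof -
  \<comment> \<open>Membership in \<open>W\<close> of velocity and acceleration is what makes the
    additivity of \<open>D\<close> and \<open>christoffel_eq\<close> applicable. The limit point
    condition also admits end points of a closed interval.\<close>
  have 1: "\<gamma>1 s \<in> W" if "s \<in> I" for s
    using has_vector_derivative_in_subspace[OF subspace_W _ d1 I(2)] that I(1) U_subset_W by blast
  then have 2: "\<gamma>2 t \<in> W"
    using has_vector_derivative_in_subspace[OF subspace_W _ d2 I(2)] t by blast
  show "\<gamma>1 t \<in> W" "\<gamma>2 t \<in> W" using 1 2 t by auto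
  show "((\<lambda>s. F (\<gamma> s)) has_vector_derivative D (\<gamma> t) (\<gamma>1 t)) (at t within I)"
    by (rule Fk_on_curve_derivative[OF subspace_W openin_U smooth_F I(1) d1[OF t] t 1[OF t]])
  have "((\<lambda>s. D (\<gamma> s) (\<gamma>1 s)) has_vector_derivative
      D (\<gamma> t) (\<gamma>2 t) + hess (\<gamma> t) (\<gamma>1 t) (\<gamma>1 t)) (at t within I)"
    unfolding hess_def
    by (rule Fk_on_curve_derivative_field[OF subspace_W openin_U smooth_F I(1) d1[OF t] t 1[OF t] _ d2[OF t] 2])
      (use 1 in auto)
  moreover have "\<gamma> t \<in> U" using I(1) t by auto
  ultimately show "((\<lambda>s. D (\<gamma> s) (\<gamma>1 s)) has_vector_derivative
      D (\<gamma> t) (\<gamma>2 t + christoffel W g (\<gamma> t) (\<gamma>1 t) (\<gamma>1 t))) (at t within I)"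
    using 1[OF t] 2 by (simp add: christoffel_eq D_add connection_in_W D_connection)
qed

lemma geodesic_on_affine:
  assumes "geodesic_on U W g I \<gamma>" "is_interval I" "\<And>t. t \<in> I \<Longrightarrow> t islimpt I"
  obtains a b where "\<And>t. t \<in> I \<Longrightarrow> F (\<gamma> t) = a + t *\<^sub>R b"
proof -
  from assms(1) obtain \<gamma>1 \<gamma>2 where im: "\<gamma> ` I \<subseteq> U"
    and d: "\<And>t. t \<in> I \<Longrightarrow> (\<gamma> has_vector_derivative \<gamma>1 t) (at t within I)"
      "\<And>t. t \<in> I \<Longrightarrow> (\<gamma>1 has_vector_derivative \<gamma>2 t) (at t within I)"
    and eq: "\<And>t. t \<in> I \<Longrightarrow> \<gamma>2 t + christoffel W g (\<gamma> t) (\<gamma>1 t) (\<gamma>1 t) = 0"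
    unfolding geodesic_on_def by blast
  note c = curve_second_derivative[OF im assms(3) d]
  have "((\<lambda>s. D (\<gamma> s) (\<gamma>1 s)) has_vector_derivative 0) (at t within I)" if "t \<in> I" for t
    using c(4)[OF _ _ _ that] eq[OF that] D_zero im that by (auto simp: image_subset_iff)
  then show ?thesis
    using affine_if_zero_second_derivative[OF assms(2) c(3)] that by blast
qed

lemma geodesic_on_affineI:
  assumes eq: "\<And>t. t \<in> I \<Longrightarrow> \<gamma> t = K (a + t *\<^sub>R b)"
  shows "geodesic_on U W g I \<gamma>"
proof -
  \<comment> \<open>The geodesic equation is verified for the curve on the whole real line, where
    derivatives are two-sided and unique, and then restricted to \<open>I\<close>.\<close>
  let ?k = "\<lambda>t::real. K (a + t *\<^sub>R b)"
  define k1 where "k1 t = E (a + t *\<^sub>R b) b" for t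
  define k2 where "k2 t = dir_deriv (\<lambda>y. E y b) (a + t *\<^sub>R b) b" for t
  have k1: "(?k has_vector_derivative k1 t) (at t)" for t
    unfolding k1_def by (rule line_K)
  have k2: "(k1 has_vector_derivative k2 t) (at t)" for t
    unfolding k1_def k2_def
    by (rule Fk_on_curve_derivative[OF subspace_UNIV _ Fk_on_dir_deriv[OF subspace_UNIV _ smooth_K],
          where \<gamma> = "\<lambda>t. a + t *\<^sub>R b" and I = UNIV])
      (auto intro!: derivative_eq_intros)
  have "k2 t + christoffel W g (?k t) (k1 t) (k1 t) = 0" for t
  proof (rule D_inj[of "?k t"])
    have im: "range ?k \<subseteq> U" using K_in_U by auto
    note c = curve_second_derivative[OF im islimpt_UNIV k1 k2 UNIV_I]
    show "k2 t + christoffel W g (?k t) (k1 t) (k1 t) \<in> W"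
      using c(1,2)[of t] K_in_U
      by (simp add: christoffel_eq connection_in_W subspace_add[OF subspace_W])
    \<comment> \<open>By \<open>D_E\<close> this function is the constant \<open>b\<close>.\<close>
    have "((\<lambda>s. D (?k s) (k1 s)) has_vector_derivative 0) (at t)"
      by (simp add: k1_def D_E)
    then show "D (?k t) (k2 t + christoffel W g (?k t) (k1 t) (k1 t)) = D (?k t) 0"
      using c(4)[of t] vector_derivative_unique_at D_zero[OF K_in_U] by metis
  qed (auto simp: K_in_U subspace_0[OF subspace_W])
  then have "(\<gamma> has_vector_derivative k1 t) (at t within I) \<and>
      (k1 has_vector_derivative k2 t) (at t within I) \<and>
      k2 t + christoffel W g (\<gamma> t) (k1 t) (k1 t) = 0" if "t \<in> I" for t
    using has_vector_derivative_transform[OF that eq has_vector_derivative_at_within[OF k1]]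
      has_vector_derivative_at_within[OF k2] eq[OF that] by simp
  moreover have "\<forall>t\<in>I. \<gamma> t \<in> U" using eq K_in_U by simp
  ultimately show ?thesis unfolding geodesic_on_def by blast
qed

lemma geodesically_complete: "geodesically_complete U W g"
  unfolding geodesically_complete_def
proof (intro ballI)
  fix p v assume p: "p \<in> U" and v: "v \<in> W"
  show "\<exists>\<gamma>. geodesic_on U W g UNIV \<gamma> \<and> \<gamma> 0 = p \<and> (\<gamma> has_vector_derivative v) (at 0)"
    using geodesic_on_affineI[of UNIV _ "F p" "D p v"] line_K[of "F p" "D p v" 0] p v
    by (intro exI[of _ "\<lambda>t. K (F p + t *\<^sub>R D p v)"]) (simp add: E_D)
qed

text \<open>In the chart a joining geodesic is affine, and its two end values fix both
  coefficients.\<close>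

lemma geodesic_joining_iff:
  assumes x: "x \<in> U" and y: "y \<in> U"
  shows "geodesic_joining U W g x y \<gamma> \<longleftrightarrow>
    (\<forall>t\<in>{0..1}. \<gamma> t = K ((1 - t) *\<^sub>R F x + t *\<^sub>R F y))"
proof
  assume j: "geodesic_joining U W g x y \<gamma>"
  have "t islimpt {0..1::real}" if "t \<in> {0..1}" for t
    using that by (simp add: islimpt_Icc)
  then obtain a b where ab: "\<And>t. t \<in> {0..1} \<Longrightarrow> F (\<gamma> t) = a + t *\<^sub>R b"
    using j geodesic_on_affine[of "{0..1}" \<gamma>] is_interval_cc unfolding geodesic_joining_def by metis
  have "F x = a" "F y = a + b" using ab[of 0] ab[of 1] j by (auto simp: geodesic_joining_def)
  then have "F (\<gamma> t) = (1 - t) *\<^sub>R F x + t *\<^sub>R F y" if "t \<in> {0..1}" for t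
    using ab[OF that] by (simp add: algebra_simps)
  then show "\<forall>t\<in>{0..1}. \<gamma> t = K ((1 - t) *\<^sub>R F x + t *\<^sub>R F y)"
    using j K_F unfolding geodesic_joining_def geodesic_on_def by metis
next
  assume eq: "\<forall>t\<in>{0..1}. \<gamma> t = K ((1 - t) *\<^sub>R F x + t *\<^sub>R F y)"
  then show "geodesic_joining U W g x y \<gamma>"
    using x y geodesic_on_affineI[of "{0..1}" \<gamma> "F x" "F y - F x"]
    by (simp add: geodesic_joining_def algebra_simps)
qed

text \<open>Joining geodesics may differ as functions outside the unit interval, but all of them
  agree at \<open>1/2\<close>, so the definite description denotes.\<close>

lemma geodesic_midpoint_eq:
  assumes x: "x \<in> U" and y: "y \<in> U"
  shows "geodesic_midpoint U W g x y = K ((1/2) *\<^sub>R F x + (1/2) *\<^sub>R F y)"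
  unfolding geodesic_midpoint_def geodesic_joining_iff[OF assms]
proof (rule the_equality)
  show "\<exists>\<gamma>. (\<forall>t\<in>{0..1}. \<gamma> t = K ((1 - t) *\<^sub>R F x + t *\<^sub>R F y)) \<and>
      K ((1/2) *\<^sub>R F x + (1/2) *\<^sub>R F y) = \<gamma> (1/2)"
    by (intro exI[of _ "\<lambda>t. K ((1 - t) *\<^sub>R F x + t *\<^sub>R F y)"]) simp
next
  fix m
  assume "\<exists>\<gamma>. (\<forall>t\<in>{0..1}. \<gamma> t = K ((1 - t) *\<^sub>R F x + t *\<^sub>R F y)) \<and> m = \<gamma> (1/2)"
  then obtain \<gamma> where \<gamma>: "\<forall>t\<in>{0..1}. \<gamma> t = K ((1 - t) *\<^sub>R F x + t *\<^sub>R F y)" and m: "m = \<gamma> (1/2)"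
    by blast
  have "\<gamma> (1/2) = K ((1 - 1/2) *\<^sub>R F x + (1/2) *\<^sub>R F y)" by (rule bspec[OF \<gamma>]) simp
  then show "m = K ((1/2) *\<^sub>R F x + (1/2) *\<^sub>R F y)" using m by simp
qed

end

section \<open>The Cholesky factorization in dimension three\<close>

lemma exhaust_5:
  fixes x :: 5
  shows "x = 1 \<or> x = 2 \<or> x = 3 \<or> x = 4 \<or> x = 5"
proof (induct x)
  case (of_int z)
  hence "0 \<le> z" and "z < 5" by simp_all
  hence "z = 0 \<or> z = 1 \<or> z = 2 \<or> z = 3 \<or> z = 4" by arith
  thus ?case by auto
qed

lemma forall_5: "(\<forall>i::5. P i) \<longleftrightarrow> P 1 \<and> P 2 \<and> P 3 \<and> P 4 \<and> P 5"
  by (metis exhaust_5)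

lemma UNIV_5: "UNIV = {1, 2, 3, 4, 5::5}"
  using exhaust_5 by auto

lemma sum_5: "sum f (UNIV::5 set) = f 1 + f 2 + f 3 + f 4 + f 5"
  unfolding UNIV_5 by (simp add: ac_simps)

lemma vector_5 [simp]:
  "(vector [a, b, c, d, e] :: 'a::zero^5)$1 = a"
  "(vector [a, b, c, d, e] :: 'a^5)$2 = b"
  "(vector [a, b, c, d, e] :: 'a^5)$3 = c"
  "(vector [a, b, c, d, e] :: 'a^5)$4 = d"
  "(vector [a, b, c, d, e] :: 'a^5)$5 = e"
  unfolding vector_def by simp_all

definition lower3 :: "real \<Rightarrow> real \<Rightarrow> real \<Rightarrow> real \<Rightarrow> real \<Rightarrow> real \<Rightarrow> real^3^3" where
  "lower3 a1 a2 a3 l21 l31 l32 = vector [vector [a1, 0, 0], vector [l21, a2, 0], vector [l31, l32, a3]]"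

lemma lower3_nth [simp]:
  "lower3 a1 a2 a3 l21 l31 l32 $ 1 $ 1 = a1" "lower3 a1 a2 a3 l21 l31 l32 $ 1 $ 2 = 0"
  "lower3 a1 a2 a3 l21 l31 l32 $ 1 $ 3 = 0" "lower3 a1 a2 a3 l21 l31 l32 $ 2 $ 1 = l21"
  "lower3 a1 a2 a3 l21 l31 l32 $ 2 $ 2 = a2" "lower3 a1 a2 a3 l21 l31 l32 $ 2 $ 3 = 0"
  "lower3 a1 a2 a3 l21 l31 l32 $ 3 $ 1 = l31" "lower3 a1 a2 a3 l21 l31 l32 $ 3 $ 2 = l32"
  "lower3 a1 a2 a3 l21 l31 l32 $ 3 $ 3 = a3"
  by (simp_all add: lower3_def)

lemma H_mat_eq_lower3: "H_mat a1 a2 a3 u4 u5 = lower3 a1 a2 a3 0 u4 u5"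
  by (simp add: H_mat_def lower3_def)

lemma Phi_nth: "Phi L $ i $ j = L$i$1 * L$j$1 + L$i$2 * L$j$2 + L$i$3 * L$j$3"
  by (simp add: Phi_def matrix_matrix_mult_def transpose_def sum_3)

lemma Sym3_iff: "A \<in> Sym3 \<longleftrightarrow> A$1$2 = A$2$1 \<and> A$1$3 = A$3$1 \<and> A$2$3 = A$3$2"
  by (auto simp: Sym3_def vec_eq_iff transpose_def forall_3)

lemma LowerPos3_iff:
  "L \<in> LowerPos3 \<longleftrightarrow> L$1$2 = 0 \<and> L$1$3 = 0 \<and> L$2$3 = 0 \<and> 0 < L$1$1 \<and> 0 < L$2$2 \<and> 0 < L$3$3"
  by (auto simp: LowerPos3_def forall_3)

lemma subspace_Sym3: "subspace Sym3"
  by (auto simp: subspace_def Sym3_iff)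

lemma subspace_V_space: "subspace V_space"
  by (auto simp: subspace_def V_space_def Sym3_iff)

text \<open>The Cholesky algorithm in closed form, reading only the lower triangle of
  \<open>A\<close>. Being explicit, it can be differentiated by the closure rules, unlike
  \<open>inv_into\<close>.\<close>

definition chol :: "real^3^3 \<Rightarrow> real^3^3" where
  "chol A = (let a1 = sqrt (A$1$1); l21 = A$2$1 / a1; l31 = A$3$1 / a1;
      a2 = sqrt (A$2$2 - l21 * l21); l32 = (A$3$2 - l31 * l21) / a2;
      a3 = sqrt (A$3$3 - l31 * l31 - l32 * l32)
    in lower3 a1 a2 a3 l21 l31 l32)"

lemma chol_nth:
  "chol A $ 1 $ 1 = sqrt (A$1$1)"
  "chol A $ 1 $ 2 = 0" "chol A $ 1 $ 3 = 0"
  "chol A $ 2 $ 1 = A$2$1 / chol A $ 1 $ 1"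
  "chol A $ 2 $ 2 = sqrt (A$2$2 - chol A $ 2 $ 1 * chol A $ 2 $ 1)"
  "chol A $ 2 $ 3 = 0"
  "chol A $ 3 $ 1 = A$3$1 / chol A $ 1 $ 1"
  "chol A $ 3 $ 2 = (A$3$2 - chol A $ 3 $ 1 * chol A $ 2 $ 1) / chol A $ 2 $ 2"
  "chol A $ 3 $ 3 = sqrt (A$3$3 - chol A $ 3 $ 1 * chol A $ 3 $ 1 - chol A $ 3 $ 2 * chol A $ 3 $ 2)"
  by (simp_all add: chol_def Let_def)

lemma quadratic_form_3:
  fixes A :: "real^3^3"
  assumes "A \<in> Sym3"
  shows "\<xi> \<bullet> (A *v \<xi>) = A$1$1 * (\<xi>$1 * \<xi>$1) + A$2$2 * (\<xi>$2 * \<xi>$2) + A$3$3 * (\<xi>$3 * \<xi>$3)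
    + 2 * A$2$1 * (\<xi>$1 * \<xi>$2) + 2 * A$3$1 * (\<xi>$1 * \<xi>$3) + 2 * A$3$2 * (\<xi>$2 * \<xi>$3)"
  using assms by (simp add: Sym3_iff inner_vec_def matrix_vector_mult_def sum_3 algebra_simps)

lemma Phi_in_SymPD3:
  assumes L: "L \<in> LowerPos3"
  shows "Phi L \<in> SymPD3"
proof -
  have S: "Phi L \<in> Sym3" by (simp add: Sym3_iff Phi_nth)
  have "0 < \<xi> \<bullet> (Phi L *v \<xi>)" if "\<xi> \<noteq> 0" for \<xi>
  proof -
    \<comment> \<open>The components of \<open>transpose L *v \<xi>\<close>: the form is the squared
      norm of this vector, and back substitution shows that it vanishes only for
      \<open>\<xi> = 0\<close>.\<close>
    define x y z where "x = L$1$1 * \<xi>$1 + L$2$1 * \<xi>$2 + L$3$1 * \<xi>$3"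
      and "y = L$2$2 * \<xi>$2 + L$3$2 * \<xi>$3" and "z = L$3$3 * \<xi>$3"
    have "\<xi> \<bullet> (Phi L *v \<xi>) = x * x + y * y + z * z"
      using L by (simp add: quadratic_form_3[OF S] Phi_nth LowerPos3_iff x_def y_def z_def algebra_simps)
    moreover have "x \<noteq> 0 \<or> y \<noteq> 0 \<or> z \<noteq> 0"
    proof (rule ccontr)
      assume "\<not> ?thesis"
      then have xyz: "x = 0" "y = 0" "z = 0" by auto
      then have "\<xi>$3 = 0" using L by (simp add: z_def LowerPos3_iff)
      moreover from this have "\<xi>$2 = 0" using L xyz by (simp add: y_def LowerPos3_iff)
      ultimately have "\<xi>$1 = 0" using L xyz by (simp add: x_def LowerPos3_iff)
      then show False using \<open>\<xi>$2 = 0\<close> \<open>\<xi>$3 = 0\<close> that by (simp add: vec_eq_iff forall_3)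
    qed
    ultimately show ?thesis
      by (metis add_nonneg_pos add_pos_nonneg add_nonneg_nonneg zero_le_square not_square_less_zero
          linorder_neqE_linordered_idom mult_pos_pos mult_neg_neg)
  qed
  then show ?thesis using S by (simp add: SymPD3_def positive_definite_def)
qed

text \<open>The entries are recovered in the order in which the algorithm produces them; positivity
  of the diagonal selects the right square roots.\<close>

lemma chol_Phi:
  assumes L: "L \<in> LowerPos3"
  shows "chol (Phi L) = L"
proof -
  note L' = L[unfolded LowerPos3_iff]
  have 11: "chol (Phi L) $ 1 $ 1 = L$1$1" using L' by (simp add: chol_nth(1) Phi_nth)
  have 21: "chol (Phi L) $ 2 $ 1 = L$2$1" using L' by (simp add: chol_nth(4) Phi_nth 11)
  have 31: "chol (Phi L) $ 3 $ 1 = L$3$1" using L' by (simp add: chol_nth(7) Phi_nth 11)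
  have 22: "chol (Phi L) $ 2 $ 2 = L$2$2" using L' by (simp add: chol_nth(5) Phi_nth 21)
  have 32: "chol (Phi L) $ 3 $ 2 = L$3$2" using L' by (simp add: chol_nth(8) Phi_nth 31 21 22)
  have 33: "chol (Phi L) $ 3 $ 3 = L$3$3" using L' by (simp add: chol_nth(9) Phi_nth 31 32)
  show ?thesis using L' 11 21 31 22 32 33 by (simp add: vec_eq_iff forall_3 chol_nth(2,3,6))
qed

text \<open>
  The last two pivots are the values of the quadratic form at the vectors \<open>(x, 1, 0)\<close> and
  \<open>(x, y, 1)\<close> annihilated by the transposes of the first one, respectively two, columns of the
  Cholesky factor.
\<close>

lemma chol_pivots:
  assumes A: "A \<in> SymPD3"
  shows "0 < A$1$1" and "0 < A$2$2 - chol A $ 2 $ 1 * chol A $ 2 $ 1"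
    and "0 < A$3$3 - chol A $ 3 $ 1 * chol A $ 3 $ 1 - chol A $ 3 $ 2 * chol A $ 3 $ 2"
proof -
  have S: "A \<in> Sym3" using A by (simp add: SymPD3_def)
  have pos: "0 < x * x * A$1$1 + y * y * A$2$2 + z * z * A$3$3
      + 2 * A$2$1 * (x * y) + 2 * A$3$1 * (x * z) + 2 * A$3$2 * (y * z)"
    if "x \<noteq> 0 \<or> y \<noteq> 0 \<or> z \<noteq> 0" for x y z
  proof -
    let ?\<xi> = "vector [x, y, z] :: real^3"
    have "?\<xi> \<noteq> 0" using that by (auto simp: vec_eq_iff forall_3)
    then have "0 < ?\<xi> \<bullet> (A *v ?\<xi>)" using A by (simp add: SymPD3_def positive_definite_def)
    then show ?thesis by (simp add: quadratic_form_3[OF S] algebra_simps)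
  qed
  define a l m where "a = chol A $ 1 $ 1" and "l = chol A $ 2 $ 1" and "m = chol A $ 3 $ 1"
  show 1: "0 < A$1$1" using pos[of 1 0 0] by simp
  have a: "a > 0" "a * a = A$1$1" using 1 by (simp_all add: a_def chol_nth(1))
  have l: "A$2$1 = a * l" "A$3$1 = a * m" using a by (simp_all add: l_def m_def a_def chol_nth(4,7))
  show 2: "0 < A$2$2 - chol A $ 2 $ 1 * chol A $ 2 $ 1"
  proof -
    have "l / a * (l / a) * A$1$1 = l * l" "a * l * (l / a) = l * l" using a(1) by (simp_all add: a(2)[symmetric])
    then show ?thesis using pos[of "- (l / a)" 1 0] a(1) by (simp add: l l_def[symmetric])
  qed
  define b n where "b = chol A $ 2 $ 2" and "n = chol A $ 3 $ 2"
  have b: "b > 0" "b * b = A$2$2 - l * l" using 2 by (simp_all add: b_def l_def chol_nth(5))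
  have n: "A$3$2 = m * l + b * n" using b(1) by (simp add: n_def m_def l_def b_def chol_nth(8)[of A])
  define y where "y = - (n / b)"
  define x where "x = - ((l * y + m) / a)"
  have xy: "a * x = - (l * y + m)" "b * y = - n" using a(1) b(1) by (simp_all add: x_def y_def)
  \<comment> \<open>Completing squares. The last two summands compensate for \<open>A$1$1\<close>
    and \<open>A$2$2\<close> not being rewritten, which leaves a polynomial identity; they vanish,
    and \<open>x\<close> and \<open>y\<close> were solved for so that the first two squares vanish
    too.\<close>
  have "x * x * A$1$1 + y * y * A$2$2 + A$3$3 + 2 * A$2$1 * (x * y) + 2 * A$3$1 * x + 2 * A$3$2 * y
    = (a * x + l * y + m) * (a * x + l * y + m) + (b * y + n) * (b * y + n) + (A$3$3 - m * m - n * n)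
      + x * x * (A$1$1 - a * a) + y * y * (A$2$2 - l * l - b * b)"
    by (simp add: l n algebra_simps)
  also have "\<dots> = A$3$3 - m * m - n * n" using a b xy by simp
  finally show "0 < A$3$3 - chol A $ 3 $ 1 * chol A $ 3 $ 1 - chol A $ 3 $ 2 * chol A $ 3 $ 2"
    using pos[of x y 1] by (simp add: m_def n_def)
qed

text \<open>Assuming positive pivots instead of positive definiteness makes this serve also as a
  criterion for positive definiteness, needed for the description of the cone by minors.\<close>

lemma Phi_chol_pivots:
  assumes "A \<in> Sym3" and piv: "0 < A$1$1" "0 < A$2$2 - chol A $ 2 $ 1 * chol A $ 2 $ 1"
    "0 < A$3$3 - chol A $ 3 $ 1 * chol A $ 3 $ 1 - chol A $ 3 $ 2 * chol A $ 3 $ 2"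
  shows "chol A \<in> LowerPos3" and "Phi (chol A) = A"
proof -
  have S: "A$1$2 = A$2$1" "A$1$3 = A$3$1" "A$2$3 = A$3$2" using assms by (auto simp: Sym3_iff)
  show L: "chol A \<in> LowerPos3" using piv chol_nth[of A] by (simp add: LowerPos3_iff)
  note pos = L[unfolded LowerPos3_iff]
  have "chol A$1$1 * chol A$1$1 = A$1$1" using piv(1) by (simp add: chol_nth(1))
  moreover have "chol A$2$2 * chol A$2$2 = A$2$2 - chol A $ 2 $ 1 * chol A $ 2 $ 1"
    using piv(2) unfolding chol_nth(5) by simp
  moreover have "chol A$3$3 * chol A$3$3 = A$3$3 - chol A $ 3 $ 1 * chol A $ 3 $ 1 - chol A $ 3 $ 2 * chol A $ 3 $ 2"
    using piv(3) unfolding chol_nth(9) by simp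
  moreover have "chol A$2$1 * chol A$1$1 = A$2$1" "chol A$3$1 * chol A$1$1 = A$3$1"
    "chol A$3$2 * chol A$2$2 = A$3$2 - chol A $ 3 $ 1 * chol A $ 2 $ 1"
    using pos unfolding chol_nth(4)[of A] chol_nth(7)[of A] chol_nth(8)[of A] by simp_all
  ultimately show "Phi (chol A) = A" using S
    by (simp add: vec_eq_iff forall_3 Phi_nth chol_nth(2,3,6) mult.commute)
qed

lemma chol_in_LowerPos3: "A \<in> SymPD3 \<Longrightarrow> chol A \<in> LowerPos3"
  and Phi_chol: "A \<in> SymPD3 \<Longrightarrow> Phi (chol A) = A"
  using Phi_chol_pivots chol_pivots by (auto simp: SymPD3_def)

section \<open>The Log-Cholesky charts\<close>

lemma SymPD3_subset_Sym3: "SymPD3 \<subseteq> Sym3"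
  by (auto simp: SymPD3_def)

text \<open>Clears denominators in the square of the \<open>(3,2)\<close> Cholesky entry
  \<open>c\<close>: \<open>a\<close> is \<open>A$1$1\<close>, \<open>b\<close> the second pivot, and
  \<open>m\<close> the numerator of \<open>c\<close>.\<close>

lemma scaled_squares:
  fixes a b c m n :: real
  assumes "b * (c * c) = m * m" "a * m = n"
  shows "a * (a * b) * (c * c) = n * n"
proof -
  have "a * (a * b) * (c * c) = a * a * (b * (c * c))" by (simp only: ac_simps)
  also have "\<dots> = n * n" unfolding assms(1) assms(2)[symmetric] by (simp only: ac_simps)
  finally show ?thesis .
qed

text \<open>\<open>d2\<close> and \<open>d3\<close> are leading principal minors, the latter multiplied by \<open>A$1$1\<close>.\<close>

lemma SymPD3_eq_minors:
  defines "d2 \<equiv> \<lambda>A::real^3^3. A$1$1 * A$2$2 - A$2$1 * A$2$1"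
  defines "d3 \<equiv> \<lambda>A::real^3^3. A$1$1 * d2 A * A$3$3 - d2 A * (A$3$1 * A$3$1)
    - (A$1$1 * A$3$2 - A$3$1 * A$2$1) * (A$1$1 * A$3$2 - A$3$1 * A$2$1)"
  shows "SymPD3 = Sym3 \<inter> {A. 0 < A$1$1 \<and> 0 < d2 A \<and> 0 < d3 A}"
proof -
  \<comment> \<open>Each new minor is the next pivot times a factor already known to be positive, so
    signs pass between minors and pivots one step at a time.\<close>
  have d2: "d2 A = A$1$1 * (A$2$2 - chol A $ 2 $ 1 * chol A $ 2 $ 1)" if "0 < A$1$1" for A
    using that by (simp add: d2_def chol_nth(1,4) algebra_simps)
  have d3: "d3 A = A$1$1 * d2 A * (A$3$3 - chol A $ 3 $ 1 * chol A $ 3 $ 1 - chol A $ 3 $ 2 * chol A $ 3 $ 2)"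
    if A1: "0 < A$1$1" and A2: "0 < d2 A" for A
  proof -
    let ?b = "A$2$2 - chol A $ 2 $ 1 * chol A $ 2 $ 1"
    have b: "?b > 0" using A2 A1 d2[OF A1] by (simp add: zero_less_mult_iff)
    have c31: "A$1$1 * (chol A $ 3 $ 1 * chol A $ 3 $ 1) = A$3$1 * A$3$1"
      using A1 by (simp add: chol_nth(1,7))
    have "chol A $ 3 $ 2 * chol A $ 3 $ 2 =
        (A$3$2 - chol A $ 3 $ 1 * chol A $ 2 $ 1) * (A$3$2 - chol A $ 3 $ 1 * chol A $ 2 $ 1) / ?b"
      using b by (simp add: chol_nth(8)[of A] chol_nth(5)[of A])
    then have "?b * (chol A $ 3 $ 2 * chol A $ 3 $ 2) =
        (A$3$2 - chol A $ 3 $ 1 * chol A $ 2 $ 1) * (A$3$2 - chol A $ 3 $ 1 * chol A $ 2 $ 1)"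
      using b by simp
    moreover have "A$1$1 * (A$3$2 - chol A $ 3 $ 1 * chol A $ 2 $ 1) = A$1$1 * A$3$2 - A$3$1 * A$2$1"
      using A1 by (simp add: chol_nth(1,4,7) algebra_simps)
    ultimately have c32: "A$1$1 * d2 A * (chol A $ 3 $ 2 * chol A $ 3 $ 2) =
        (A$1$1 * A$3$2 - A$3$1 * A$2$1) * (A$1$1 * A$3$2 - A$3$1 * A$2$1)"
      unfolding d2[OF A1] by (rule scaled_squares)
    show ?thesis unfolding d3_def using c31 c32 by (simp add: algebra_simps)
  qed
  show ?thesis
  proof (intro equalityI subsetI)
    fix A assume A: "A \<in> SymPD3"
    note p = chol_pivots[OF A]
    have "0 < d2 A" using p d2 by simp
    moreover from this have "0 < d3 A" using p d3 by simp
    ultimately show "A \<in> Sym3 \<inter> {A. 0 < A$1$1 \<and> 0 < d2 A \<and> 0 < d3 A}"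
      using A p SymPD3_subset_Sym3 by auto
  next
    fix A assume A: "A \<in> Sym3 \<inter> {A. 0 < A$1$1 \<and> 0 < d2 A \<and> 0 < d3 A}"
    then have S: "A \<in> Sym3" and 1: "0 < A$1$1" and "0 < d2 A" "0 < d3 A" by auto
    have 2: "0 < A$2$2 - chol A $ 2 $ 1 * chol A $ 2 $ 1"
      using \<open>0 < d2 A\<close> 1 d2[OF 1] zero_less_mult_pos by metis
    have 3: "0 < A$3$3 - chol A $ 3 $ 1 * chol A $ 3 $ 1 - chol A $ 3 $ 2 * chol A $ 3 $ 2"
      using \<open>0 < d3 A\<close> 1 \<open>0 < d2 A\<close> d3[OF 1 \<open>0 < d2 A\<close>] zero_less_mult_pos mult_pos_pos by metis
    show "A \<in> SymPD3" using Phi_chol_pivots[OF S 1 2 3] Phi_in_SymPD3 by metis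
  qed
qed

text \<open>The minors are polynomials in the entries, so strict inequalities between them cut out
  an open set.\<close>

lemma openin_SymPD3: "openin (top_of_set Sym3) SymPD3"
  unfolding SymPD3_eq_minors
  by (intro openin_open_Int open_Collect_conj open_Collect_less continuous_intros)

lemma Omega_eq: "Omega = SymPD3 \<inter> V_space"
  by (auto simp: Omega_def SymPD3_def V_space_def)

lemma V_space_subset_Sym3: "V_space \<subseteq> Sym3"
  by (auto simp: V_space_def)

lemma openin_Omega: "openin (top_of_set V_space) Omega"
proof -
  obtain T where "open T" "SymPD3 = Sym3 \<inter> T" using openin_SymPD3 by (auto simp: openin_open)
  then have "Omega = V_space \<inter> T" using V_space_subset_Sym3 by (auto simp: Omega_eq)
  with \<open>open T\<close> show ?thesis by (auto simp: openin_open)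
qed

lemma inv_into_LowerPos3:
  assumes "A \<in> SymPD3"
  shows "inv_into LowerPos3 (\<lambda>L. L ** transpose L) A = chol A"
proof -
  have "(\<lambda>L. L ** transpose L) = Phi" by (simp add: Phi_def fun_eq_iff)
  moreover have "inj_on Phi LowerPos3" by (metis chol_Phi inj_onI)
  ultimately show ?thesis
    using inv_into_f_eq[of Phi LowerPos3 "chol A" A] chol_in_LowerPos3 Phi_chol assms by simp
qed

text \<open>If \<open>A$2$1 = 0\<close>, the algorithm returns 0 in position \<open>(2,1)\<close>,
  so the ambient factor already lies in \<open>H_group\<close> and \<open>chol\<close> inverts both
  parametrizations.\<close>

lemma inv_into_H_group:
  assumes "A \<in> Omega"
  shows "inv_into H_group Phi A = chol A"
proof (rule inv_into_f_eq)
  have "A \<in> SymPD3" "A$2$1 = 0" using assms by (auto simp: Omega_eq V_space_def)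
  then show "chol A \<in> H_group" "Phi (chol A) = A"
    by (simp_all add: H_group_def chol_in_LowerPos3 chol_nth(4) Phi_chol)
  have "inj_on Phi LowerPos3" by (metis chol_Phi inj_onI)
  then show "inj_on Phi H_group" by (rule inj_on_subset) (auto simp: H_group_def)
qed

lemma Phi_in_Omega: "L \<in> H_group \<Longrightarrow> Phi L \<in> Omega"
  using Phi_in_SymPD3[of L]
  by (auto simp: Omega_eq V_space_def H_group_def LowerPos3_iff Phi_nth SymPD3_def)

lemma G_map_eq: "A \<in> Omega \<Longrightarrow> G_map A = Psi (chol A)"
  by (simp add: G_map_def inv_into_H_group)

lemma Fk_on_Phi: "Fk_on k U f \<Longrightarrow> Fk_on k U (\<lambda>p. Phi (f p))"
  by (intro Fk_on_vec) (simp add: Phi_nth Fk_on_add Fk_on_mult Fk_on_nth)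

lemma Fk_on_lower3:
  assumes "Fk_on k U a1" "Fk_on k U a2" "Fk_on k U a3" "Fk_on k U b1" "Fk_on k U b2" "Fk_on k U b3"
  shows "Fk_on k U (\<lambda>p. lower3 (a1 p) (a2 p) (a3 p) (b1 p) (b2 p) (b3 p))"
proof -
  have "\<forall>i j. Fk_on k U (\<lambda>p. lower3 (a1 p) (a2 p) (a3 p) (b1 p) (b2 p) (b3 p) $ i $ j)"
    using assms by (simp add: forall_3 Fk_on_const)
  then show ?thesis by (intro Fk_on_vec) simp
qed

text \<open>The entries are treated in the order of the algorithm; \<open>chol_pivots\<close>
  supplies positive radicands and hence nonzero denominators.\<close>

lemma Fk_on_chol: "Fk_on k SymPD3 chol"
proof -
  note pos = chol_pivots and L = chol_in_LowerPos3[unfolded LowerPos3_iff]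
  have e: "Fk_on k SymPD3 (\<lambda>A. A$i$j)" for i j by (intro Fk_on_nth Fk_on_ident)
  have 11: "Fk_on k SymPD3 (\<lambda>A. chol A$1$1)"
    unfolding chol_nth(1) by (intro Fk_on_sqrt e pos)
  have 21: "Fk_on k SymPD3 (\<lambda>A. chol A$2$1)"
    unfolding chol_nth(4) by (intro Fk_on_divide e 11) (use L in force)
  have 31: "Fk_on k SymPD3 (\<lambda>A. chol A$3$1)"
    unfolding chol_nth(7) by (intro Fk_on_divide e 11) (use L in force)
  have 22: "Fk_on k SymPD3 (\<lambda>A. chol A$2$2)"
    unfolding chol_nth(5) by (intro Fk_on_sqrt Fk_on_diff Fk_on_mult e 21 pos)
  have 32: "Fk_on k SymPD3 (\<lambda>A. chol A$3$2)"
    unfolding chol_nth(8) by (intro Fk_on_divide Fk_on_diff Fk_on_mult e 31 21 22) (use L in force)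
  have 33: "Fk_on k SymPD3 (\<lambda>A. chol A$3$3)"
    unfolding chol_nth(9) by (intro Fk_on_sqrt Fk_on_diff Fk_on_mult e 31 32 pos)
  have "\<forall>i j. Fk_on k SymPD3 (\<lambda>A. chol A $ i $ j)"
    using 11 21 31 22 32 33 by (simp add: forall_3 chol_nth(2,3,6) Fk_on_const)
  then show ?thesis by (intro Fk_on_vec) simp
qed

lemma Psi_nth [simp]:
  "Psi L $ 1 = ln (L$1$1)" "Psi L $ 2 = ln (L$2$2)" "Psi L $ 3 = ln (L$3$3)"
  "Psi L $ 4 = L$3$1" "Psi L $ 5 = L$3$2"
  by (simp_all add: Psi_def)

lemma Fk_on_Psi_chol: "Fk_on k SymPD3 (\<lambda>A. Psi (chol A))"
proof -
  note L = chol_in_LowerPos3[unfolded LowerPos3_iff]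
  have e: "Fk_on k SymPD3 (\<lambda>A. chol A$i$j)" for i j by (intro Fk_on_nth Fk_on_chol)
  have "\<forall>i. Fk_on k SymPD3 (\<lambda>A. Psi (chol A) $ i)"
    by (auto simp: forall_5 intro!: Fk_on_ln e) (use L in blast)+
  then show ?thesis by (intro Fk_on_vec) simp
qed

text \<open>Stated for any relatively open \<open>U\<close> inside \<open>SymPD3\<close>, so that
  one computation serves both cones; the ambient metric only adds the \<open>(2,1)\<close>
  term.\<close>

lemma inner_dir_deriv_Psi_chol:
  assumes W: "subspace W" "openin (top_of_set W) U" and sub: "U \<subseteq> SymPD3"
    and p: "p \<in> U" and v: "v \<in> W" and w: "w \<in> W"
  shows "dir_deriv (\<lambda>A. Psi (chol A)) p v \<bullet> dir_deriv (\<lambda>A. Psi (chol A)) p w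
    = g_H (chol p) (dir_deriv chol p v) (dir_deriv chol p w)"
proof -
  \<comment> \<open>The differential of \<open>Psi\<close> at \<open>chol p\<close>; the quotients
    are the differentials of the logarithms.\<close>
  define dPsi :: "real^3^3 \<Rightarrow> real^5" where
    "dPsi X = vector [X$1$1 / chol p$1$1, X$2$2 / chol p$2$2, X$3$3 / chol p$3$3, X$3$1, X$3$2]" for X
  have nth: "dir_deriv (\<lambda>A. Psi (chol A)) p x = dPsi (dir_deriv chol p x)" if "x \<in> W" for x
  proof -
    let ?X = "dir_deriv chol p x"
    have d: "((\<lambda>t. chol (p + t *\<^sub>R x) $ i $ j) has_vector_derivative ?X $ i $ j) (at 0)" for i j
      by (intro bounded_linear.has_vector_derivative[OF bounded_linear_vec_nth]
          Fk_on_line_derivative[OF W Fk_on_subset[OF Fk_on_chol sub] p that])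
    have dln: "((\<lambda>t. ln (chol (p + t *\<^sub>R x) $ i $ i)) has_vector_derivative ?X $ i $ i / chol p $ i $ i) (at 0)" for i
    proof -
      have "chol p $ i $ i > 0" using chol_in_LowerPos3 p sub by (auto simp: LowerPos3_def)
      then show ?thesis
        using d[of i i] unfolding has_real_derivative_iff_has_vector_derivative[symmetric]
        by (auto intro!: derivative_eq_intros)
    qed
    have P: "((\<lambda>t. Psi (chol (p + t *\<^sub>R x)) $ i) has_vector_derivative
        dir_deriv (\<lambda>A. Psi (chol A)) p x $ i) (at 0)" for i
      by (intro bounded_linear.has_vector_derivative[OF bounded_linear_vec_nth]
          Fk_on_line_derivative[OF W Fk_on_subset[OF Fk_on_Psi_chol sub] p that])
    show ?thesis
      using P[of 1] P[of 2] P[of 3] P[of 4] P[of 5] dln[of 1] dln[of 2] dln[of 3] d[of 3 1] d[of 3 2]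
      by (simp add: dPsi_def vec_eq_iff forall_5 vector_derivative_unique_at)
  qed
  show ?thesis
    using nth[OF v] nth[OF w] by (simp add: dPsi_def inner_vec_def sum_5 g_H_def sum_3)
qed

text \<open>The \<open>(2,1)\<close> entry is kept in a separate factor, so that the subcone is the
  set with second component 0 and the first component restricts to \<open>G_map\<close>.\<close>

definition chol_coords :: "real^3^3 \<Rightarrow> (real^5) \<times> real" where
  "chol_coords A = (Psi (chol A), chol A $ 2 $ 1)"

definition from_chol_coords :: "(real^5) \<times> real \<Rightarrow> real^3^3" where
  "from_chol_coords y = Phi (lower3 (exp (fst y $ 1)) (exp (fst y $ 2)) (exp (fst y $ 3))
    (snd y) (fst y $ 4) (fst y $ 5))"

lemma chol_from_chol_coords:
  "chol (from_chol_coords y) = lower3 (exp (fst y $ 1)) (exp (fst y $ 2)) (exp (fst y $ 3))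
    (snd y) (fst y $ 4) (fst y $ 5)"
  unfolding from_chol_coords_def by (intro chol_Phi) (simp add: LowerPos3_iff)

lemma from_chol_coords_in_SymPD3: "from_chol_coords y \<in> SymPD3"
  unfolding from_chol_coords_def by (intro Phi_in_SymPD3) (simp add: LowerPos3_iff)

lemma chol_coords_from_chol_coords [simp]: "chol_coords (from_chol_coords y) = y"
  by (cases y) (simp add: chol_coords_def chol_from_chol_coords vec_eq_iff forall_5)

lemma from_chol_coords_chol_coords:
  assumes "A \<in> SymPD3"
  shows "from_chol_coords (chol_coords A) = A"
proof -
  have "lower3 (chol A $1$1) (chol A $2$2) (chol A $3$3) (chol A $2$1) (chol A $3$1) (chol A $3$2) = chol A"
    by (simp add: vec_eq_iff forall_3 chol_nth(2,3,6))
  then show ?thesis using chol_in_LowerPos3[OF assms] Phi_chol[OF assms]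
    by (simp add: from_chol_coords_def chol_coords_def LowerPos3_iff)
qed

lemma Fk_on_from_chol_coords: "Fk_on k UNIV from_chol_coords"
  unfolding from_chol_coords_def
  by (intro Fk_on_Phi Fk_on_lower3 Fk_on_exp Fk_on_nth bounded_linear.Fk_on[OF bounded_linear_fst]
      bounded_linear.Fk_on[OF bounded_linear_snd] Fk_on_ident)

interpretation ambient: flat_chart SymPD3 Sym3 chol_coords from_chol_coords g_LC_ambient
proof
  show "subspace Sym3" by (rule subspace_Sym3)
  show "openin (top_of_set Sym3) SymPD3" by (rule openin_SymPD3)
  show s: "Fk_on k SymPD3 chol_coords" for k
    unfolding chol_coords_def by (intro Fk_on_Pair Fk_on_Psi_chol Fk_on_nth Fk_on_chol)
  show "Fk_on k UNIV from_chol_coords" for k by (rule Fk_on_from_chol_coords)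
  fix p v w assume p: "p \<in> SymPD3" and v: "v \<in> Sym3" and w: "w \<in> Sym3"
  note W = subspace_Sym3 openin_SymPD3
  have D: "dir_deriv chol_coords p x = (dir_deriv (\<lambda>A. Psi (chol A)) p x, dir_deriv chol p x $ 2 $ 1)"
    if x: "x \<in> Sym3" for x
  proof -
    note c = Fk_on_line_derivative[OF W s p x]
    have "((\<lambda>t. Psi (chol (p + t *\<^sub>R x))) has_vector_derivative fst (dir_deriv chol_coords p x)) (at 0)"
      "((\<lambda>t. chol (p + t *\<^sub>R x) $ 2 $ 1) has_vector_derivative snd (dir_deriv chol_coords p x)) (at 0)"
      using bounded_linear.has_vector_derivative[OF bounded_linear_fst c]
        bounded_linear.has_vector_derivative[OF bounded_linear_snd c] by (simp_all add: chol_coords_def)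
    moreover have "((\<lambda>t. Psi (chol (p + t *\<^sub>R x))) has_vector_derivative dir_deriv (\<lambda>A. Psi (chol A)) p x) (at 0)"
      by (rule Fk_on_line_derivative[OF W Fk_on_Psi_chol p x])
    moreover have "((\<lambda>t. chol (p + t *\<^sub>R x) $ 2 $ 1) has_vector_derivative dir_deriv chol p x $ 2 $ 1) (at 0)"
      by (intro bounded_linear.has_vector_derivative[OF bounded_linear_vec_nth]
          Fk_on_line_derivative[OF W Fk_on_chol p x])
    ultimately show ?thesis by (metis vector_derivative_unique_at prod.collapse)
  qed
  have "dir_deriv (inv_into LowerPos3 (\<lambda>L. L ** transpose L)) p x = dir_deriv chol p x" if "x \<in> Sym3" for x
    by (rule dir_deriv_cong[OF W p that]) (rule inv_into_LowerPos3)
  then have "g_LC_ambient p v w = g_lower (chol p) (dir_deriv chol p v) (dir_deriv chol p w)"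
    using inv_into_LowerPos3[OF p] v w by (simp add: g_LC_ambient_def transport_metric_def)
  \<comment> \<open>The inner product on the product space adds to \<open>g_H\<close> the product of
    the second components, which is the \<open>(2,1)\<close> term of \<open>g_lower\<close>.\<close>
  also have "\<dots> = dir_deriv chol_coords p v \<bullet> dir_deriv chol_coords p w"
    by (simp add: D v w inner_dir_deriv_Psi_chol[OF W subset_refl p v w] g_H_def g_lower_def)
  finally show "g_LC_ambient p v w = dir_deriv chol_coords p v \<bullet> dir_deriv chol_coords p w" .
qed (auto simp: from_chol_coords_in_SymPD3 from_chol_coords_chol_coords)

lemma chol_coords_Omega: "A \<in> Omega \<Longrightarrow> chol_coords A = (G_map A, 0)"
  by (simp add: chol_coords_def G_map_eq) (simp add: chol_nth(4) Omega_eq V_space_def)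

lemma from_chol_coords_in_Omega: "from_chol_coords (y, 0) \<in> Omega"
  unfolding from_chol_coords_def by (intro Phi_in_Omega) (simp add: H_group_def LowerPos3_iff)

interpretation Omega: flat_chart Omega V_space G_map "\<lambda>y. from_chol_coords (y, 0)" g_LC
proof
  note W = subspace_V_space openin_Omega
  have sub: "Omega \<subseteq> SymPD3" by (simp add: Omega_eq)
  show "subspace V_space" "openin (top_of_set V_space) Omega" by (fact W)+
  have G: "dir_deriv G_map p x = dir_deriv (\<lambda>A. Psi (chol A)) p x" if "p \<in> Omega" "x \<in> V_space" for p x
    by (rule dir_deriv_cong[OF W that]) (rule G_map_eq)
  show "Fk_on k Omega G_map" for k
    using Fk_on_subset[OF Fk_on_Psi_chol sub] Fk_on_cong[of Omega G_map] G_map_eq by simp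
  show "Fk_on k UNIV (\<lambda>y. from_chol_coords (y, 0))" for k
    by (rule Fk_on_compose[OF Fk_on_from_chol_coords]) (auto intro: Fk_on_Pair Fk_on_ident Fk_on_const)
  show "from_chol_coords (y, 0) \<in> Omega" for y by (rule from_chol_coords_in_Omega)
  show "G_map (from_chol_coords (y, 0)) = y" for y
    using chol_coords_Omega[OF from_chol_coords_in_Omega, of y] by simp
  show "from_chol_coords (G_map p, 0) = p" if "p \<in> Omega" for p
    using chol_coords_Omega[OF that] from_chol_coords_chol_coords[of p] that sub by auto
  fix p v w assume p: "p \<in> Omega" and v: "v \<in> V_space" and w: "w \<in> V_space"
  have "dir_deriv (inv_into H_group Phi) p x = dir_deriv chol p x" if "x \<in> V_space" for x
    by (rule dir_deriv_cong[OF W p that]) (rule inv_into_H_group)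
  then show "g_LC p v w = dir_deriv G_map p v \<bullet> dir_deriv G_map p w"
    using inv_into_H_group[OF p] v w p
    by (simp add: g_LC_def transport_metric_def G inner_dir_deriv_Psi_chol[OF W sub p v w])
qed

text \<open>Appending the coordinate 0 keeps affine lines affine, and along \<open>V_space\<close>
  the appended coordinate has zero differential, so the induced metric is the intrinsic one.\<close>

lemma Omega_totally_geodesic: "totally_geodesic_in Omega V_space g_LC SymPD3 Sym3 g_LC_ambient"
  unfolding totally_geodesic_in_def
proof (intro conjI ballI allI impI)
  show "Omega \<subseteq> SymPD3" by (simp add: Omega_eq)
  show "V_space \<subseteq> Sym3" by (rule V_space_subset_Sym3)
next
  fix p v w assume p: "p \<in> Omega" and v: "v \<in> V_space" and w: "w \<in> V_space"
  have D: "dir_deriv chol_coords p x = (dir_deriv G_map p x, 0)" if x: "x \<in> V_space" for x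
  proof -
    have "dir_deriv chol_coords p x = dir_deriv (\<lambda>A. (G_map A, 0)) p x"
      by (rule dir_deriv_cong[OF subspace_V_space openin_Omega p x]) (rule chol_coords_Omega)
    also have "((\<lambda>t. (G_map (p + t *\<^sub>R x), 0::real)) has_vector_derivative (dir_deriv G_map p x, 0)) (at 0)"
      using bounded_linear.has_vector_derivative[OF bounded_linear_Pair[OF bounded_linear_ident bounded_linear_zero]
          Omega.line_F[OF p x]] .
    then have "dir_deriv (\<lambda>A. (G_map A, 0::real)) p x = (dir_deriv G_map p x, 0)"
      unfolding dir_deriv_def[of "\<lambda>A. (G_map A, 0)"] by (rule vector_derivative_at)
    finally show ?thesis .
  qed
  have "p \<in> SymPD3" "v \<in> Sym3" "w \<in> Sym3" using p v w V_space_subset_Sym3 by (auto simp: Omega_eq)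
  then show "g_LC p v w = g_LC_ambient p v w"
    by (simp add: Omega.metric_eq[OF p v w] ambient.metric_eq D v w)
next
  fix I \<gamma> assume a: "open I \<and> is_interval I \<and> geodesic_on Omega V_space g_LC I \<gamma>"
  then obtain a b where ab: "\<And>t. t \<in> I \<Longrightarrow> G_map (\<gamma> t) = a + t *\<^sub>R b"
    using Omega.geodesic_on_affine[of I \<gamma>] interior_limit_point[of _ I] interior_open by metis
  show "geodesic_on SymPD3 Sym3 g_LC_ambient I \<gamma>"
  proof (rule ambient.geodesic_on_affineI)
    fix t assume t: "t \<in> I"
    then have \<gamma>: "\<gamma> t \<in> Omega" using a by (auto simp: geodesic_on_def)
    show "\<gamma> t = from_chol_coords ((a, 0) + t *\<^sub>R (b, 0))"
      using Omega.K_F[OF \<gamma>] ab[OF t] by simp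
  qed
qed (rule Omega.riemannian_metric ambient.riemannian_metric)+

text \<open>Linear interpolation of logarithms is geometric interpolation of the positive diagonal
  entries: \<open>exp ((1 - t) * ln a + t * ln b)\<close> is
  \<open>a powr (1 - t) * b powr t\<close>.\<close>

lemma from_chol_coords_interpolation:
  assumes x: "x \<in> Omega" and y: "y \<in> Omega"
    and a: "inv_into H_group Phi x = H_mat a1 a2 a3 u4 u5"
    and b: "inv_into H_group Phi y = H_mat b1 b2 b3 v4 v5"
  shows "from_chol_coords ((1 - t) *\<^sub>R G_map x + t *\<^sub>R G_map y, 0) =
    Phi (H_mat (a1 powr (1 - t) * b1 powr t) (a2 powr (1 - t) * b2 powr t)
      (a3 powr (1 - t) * b3 powr t) ((1 - t) * u4 + t * v4) ((1 - t) * u5 + t * v5))"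
proof -
  have c: "chol x = lower3 a1 a2 a3 0 u4 u5" "chol y = lower3 b1 b2 b3 0 v4 v5"
    using a b inv_into_H_group x y by (simp_all add: H_mat_eq_lower3)
  have "chol x \<in> LowerPos3" "chol y \<in> LowerPos3" using x y chol_in_LowerPos3 by (auto simp: Omega_eq)
  then have "a1 > 0" "a2 > 0" "a3 > 0" "b1 > 0" "b2 > 0" "b3 > 0" by (simp_all add: c LowerPos3_iff)
  then show ?thesis
    by (simp add: from_chol_coords_def H_mat_eq_lower3 G_map_eq x y c powr_def exp_add mult.commute)
qed

theorem proposition8p1:
  "riemannian_isometry Omega V_space g_LC (UNIV :: (real^5) set) UNIV standard_metric G_map
   \<and> flat_metric Omega V_space g_LC
   \<and> geodesically_complete Omega V_space g_LC
   \<and> totally_geodesic_in Omega V_space g_LC SymPD3 Sym3 g_LC_ambient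
   \<and> (\<forall>x\<in>Omega. \<forall>y\<in>Omega. \<forall>a1 a2 a3 u4 u5 b1 b2 b3 v4 v5 :: real.
        inv_into H_group Phi x = H_mat a1 a2 a3 u4 u5 \<longrightarrow>
        inv_into H_group Phi y = H_mat b1 b2 b3 v4 v5 \<longrightarrow>
        (let T = (\<lambda>t. H_mat (a1 powr (1 - t) * b1 powr t) (a2 powr (1 - t) * b2 powr t)
                            (a3 powr (1 - t) * b3 powr t)
                            ((1 - t) * u4 + t * v4) ((1 - t) * u5 + t * v5));
             \<gamma> = (\<lambda>t. Phi (T t));
             m = geodesic_midpoint Omega V_space g_LC x y
         in geodesic_joining Omega V_space g_LC x y \<gamma>
            \<and> (\<forall>\<delta>. geodesic_joining Omega V_space g_LC x y \<delta> \<longrightarrow> (\<forall>t\<in>{0..1}. \<delta> t = \<gamma> t))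
            \<and> m = Phi (T (1/2))
            \<and> (\<forall>t\<in>{0..1}. \<gamma> t $ 1 $ 2 = 0 \<and> \<gamma> t $ 2 $ 1 = 0)
            \<and> m $ 1 $ 2 = 0 \<and> m $ 2 $ 1 = 0))"
proof (intro conjI ballI allI impI)
  fix x y a1 a2 a3 u4 u5 b1 b2 b3 v4 v5
  assume x: "x \<in> Omega" and y: "y \<in> Omega"
    and a: "inv_into H_group Phi x = H_mat a1 a2 a3 u4 u5"
    and b: "inv_into H_group Phi y = H_mat b1 b2 b3 v4 v5"
  define T where "T t = H_mat (a1 powr (1 - t) * b1 powr t) (a2 powr (1 - t) * b2 powr t)
    (a3 powr (1 - t) * b3 powr t) ((1 - t) * u4 + t * v4) ((1 - t) * u5 + t * v5)" for t
  have geo: "from_chol_coords ((1 - t) *\<^sub>R G_map x + t *\<^sub>R G_map y, 0) = Phi (T t)" for t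
    unfolding T_def by (rule from_chol_coords_interpolation[OF x y a b])
  \<comment> \<open>The first two rows of \<open>T t\<close> have disjoint supports, so their inner
    product is 0.\<close>
  have zero: "Phi (T t) $ 1 $ 2 = 0 \<and> Phi (T t) $ 2 $ 1 = 0" for t
    by (simp add: T_def H_mat_eq_lower3 Phi_nth)
  have mid: "geodesic_midpoint Omega V_space g_LC x y = Phi (T (1/2))"
    using Omega.geodesic_midpoint_eq[OF x y] geo[of "1/2"] by simp
  \<comment> \<open>After rewriting with \<open>geo\<close> the equivalence yields both that the
    stated curve is a joining geodesic and that any other agrees with it on the unit
    interval.\<close>
  note joining = Omega.geodesic_joining_iff[OF x y, unfolded geo]
  show "let T = (\<lambda>t. H_mat (a1 powr (1 - t) * b1 powr t) (a2 powr (1 - t) * b2 powr t)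
                            (a3 powr (1 - t) * b3 powr t)
                            ((1 - t) * u4 + t * v4) ((1 - t) * u5 + t * v5));
             \<gamma> = (\<lambda>t. Phi (T t));
             m = geodesic_midpoint Omega V_space g_LC x y
         in geodesic_joining Omega V_space g_LC x y \<gamma>
            \<and> (\<forall>\<delta>. geodesic_joining Omega V_space g_LC x y \<delta> \<longrightarrow> (\<forall>t\<in>{0..1}. \<delta> t = \<gamma> t))
            \<and> m = Phi (T (1/2))
            \<and> (\<forall>t\<in>{0..1}. \<gamma> t $ 1 $ 2 = 0 \<and> \<gamma> t $ 2 $ 1 = 0)
            \<and> m $ 1 $ 2 = 0 \<and> m $ 2 $ 1 = 0"
    unfolding Let_def T_def[symmetric] mid joining using zero by blast
qed (rule Omega.isometry Omega.flat Omega.geodesically_complete Omega_totally_geodesic)+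

end
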